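(* Let $\{b_\alpha\}_{\alpha\in\mathbb F_n^+}$ be a collection of strictly positive real numbers such that $b_{g_0}=1$ and $\sup_{\alpha\in\mathbb F_n^+}\frac{b_\alpha}{b_{g_i\alpha}}<\infty$ for every $i\in\{1,\ldots,n\}$, and let ${\bf W}=(W_1,\ldots,W_n)$ be the associated $n$-tuple of weighted left creation operators on the full Fock space $F^2(H_n)$. If $T=(T_1,\ldots,T_n)\in B(\mathcal H)^n$, then the following statements are equivalent. (i) There is a Hilbert space $\mathcal E$ and an operator $V:\mathcal H\to F^2(H_n)\otimes\mathcal E$ such that $VT_i^*=(W_i^*\otimes I_{\mathcal E})V$ for $i\in\{1,\ldots,n\}$. (ii) There is a Hilbert space $\mathcal E$ and an operator $\Theta_0\in B(\mathcal H,\mathcal E)$, $\Theta_0\ne0$, such that the series $\sum_{\alpha\in\mathbb F_n^+}b_\alpha T_\alpha\Theta_0^*\Theta_0T_\alpha^*$ converges in the weak operator topology. (iii) There is a positive operator $D(T)\in B(\mathcal H)$ such that the series $\sum_{\alpha\in\mathbb F_n^+}b_\alpha T_\alpha D(T)T_\alpha^*$ converges in the weak operator topology. If condition (iii) holds, then the operator $\widetilde V:\mathcal H\to F^2(H_n)\otimes\mathcal D$ defined by $$\widetilde Vh:=\sum_{\alpha\in\mathbb F_n^+}\sqrt{b_\alpha}\,e_\alpha\otimes D(T)^{1/2}T_\alpha^*h,\qquad h\in\mathcal H,$$ where $\mathcal D:=\overline{D(T)\mathcal H}$, satisfies $\widetilde VT_i^*=(W_i^*\otimes I_{\mathcal D})\widetilde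 V$ for $i\in\{1,\ldots,n\}$. In addition, $\widetilde V$ is an isometry if and only if $\sum_{\alpha\in\mathbb F_n^+}b_\alpha T_\alpha D(T)T_\alpha^*=I_{\mathcal H}$, where the convergence is in the weak operator topology.
   Context: $\mathbb F_n^+$ is the unital free semigroup on generators $g_1,\ldots,g_n$ with identity $g_0$. $B(\mathcal H)$ (resp. $B(\mathcal H,\mathcal E)$) is the set of bounded linear operators on the Hilbert space $\mathcal H$ (resp. from $\mathcal H$ to $\mathcal E$); operators are bounded and linear. For $\alpha=g_{i_1}\cdots g_{i_k}$ and $T=(T_1,\ldots,T_n)\in B(\mathcal H)^n$, $T_\alpha:=T_{i_1}\cdots T_{i_k}$ and $T_{g_0}:=I$. $F^2(H_n)=\bigoplus_{k\ge0}H_n^{\otimes k}$ is the full Fock space of an $n$-dimensional Hilbert space $H_n$ with orthonormal basis $e_1,\ldots,e_n$; with $e_\alpha:=e_{i_1}\otimes\cdots\otimes e_{i_k}$ and $e_{g_0}:=1$, $\{e_\alpha\}_{\alpha\in\mathbb F_n^+}$ is an orthonormal basis of $F^2(H_n)$. The weighted left creation operators associated with $\{b_\alpha\}$ are the bounded operators on $F^2(H_n)$ given by $W_ie_\alpha=\sqrt{b_\alpha/b_{g_i\alpha}}\;e_{g_i\alpha}$, $\alpha\in\mathbb F_n^+$.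
   Formalization: The operator V in (i) and the positive operator D(T) in (iii) are required to be nonzero; otherwise V = 0 and D(T) = 0 always satisfy (i) and (iii), while (ii) fails e.g. for n = 1, b = 1, T = 2I on the complex numbers. *)

theory Defs
  imports "HOL-Analysis.Analysis"
begin

section \<open>Complex Hilbert spaces\<close>

text \<open>The inner product is linear in the first argument. The norm is required to be the one induced
  by the inner product, so positive definiteness follows from the axioms of a normed space.\<close>

class complex_hilbert = banach +
  fixes scaleC :: "complex \<Rightarrow> 'a \<Rightarrow> 'a"  (infixr "*\<^sub>C" 75)
    and cinner :: "'a \<Rightarrow> 'a \<Rightarrow> complex"
  assumes scaleC_of_real: "complex_of_real r *\<^sub>C x = r *\<^sub>R x"
    and scaleC_add_right: "c *\<^sub>C (x + y) = c *\<^sub>C x + c *\<^sub>C y"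
    and scaleC_add_left: "(c + d) *\<^sub>C x = c *\<^sub>C x + d *\<^sub>C x"
    and scaleC_scaleC: "c *\<^sub>C d *\<^sub>C x = (c * d) *\<^sub>C x"
    and cinner_add_left: "cinner (x + y) z = cinner x z + cinner y z"
    and cinner_scaleC_left: "cinner (c *\<^sub>C x) y = c * cinner x y"
    and cinner_commute: "cinner x y = cnj (cinner y x)"
    and cinner_self: "cinner x x = complex_of_real ((norm x)\<^sup>2)"

lemma scaleC_one: "1 *\<^sub>C x = (x :: 'a::complex_hilbert)"
  using scaleC_of_real[of 1 x] by simp

global_interpretation complex_vector: vector_space "scaleC :: complex \<Rightarrow> 'a \<Rightarrow> 'a::complex_hilbert"
  defines csubspace = complex_vector.subspace
    and cspan = complex_vector.span
  by unfold_locales (auto simp: scaleC_add_right scaleC_add_left scaleC_scaleC scaleC_one)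

lemma cinner_add_right: "cinner x (y + z) = cinner x y + cinner x (z :: 'a::complex_hilbert)"
  by (metis cinner_add_left cinner_commute complex_cnj_add)

lemma cinner_scaleC_right: "cinner x (c *\<^sub>C y) = cnj c * cinner x (y :: 'a::complex_hilbert)"
  by (metis cinner_scaleC_left cinner_commute complex_cnj_mult)

lemma cinner_zero_left [simp]: "cinner 0 (x :: 'a::complex_hilbert) = 0"
  using cinner_scaleC_left[of 0 x x] by simp

lemma cinner_zero_right [simp]: "cinner (x :: 'a::complex_hilbert) 0 = 0"
  by (metis cinner_commute cinner_zero_left complex_cnj_zero)

lemma norm_scaleC: "norm (c *\<^sub>C x) = cmod c * norm (x :: 'a::complex_hilbert)"
proof -
  have "complex_of_real ((norm (c *\<^sub>C x))\<^sup>2) = c * cnj c * complex_of_real ((norm x)\<^sup>2)"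
    by (simp only: cinner_self[symmetric] cinner_scaleC_left cinner_scaleC_right mult_ac)
  also have "\<dots> = complex_of_real ((cmod c * norm x)\<^sup>2)"
    by (simp only: complex_norm_square[symmetric] power_mult_distrib of_real_mult of_real_power)
  finally have "(norm (c *\<^sub>C x))\<^sup>2 = (cmod c * norm x)\<^sup>2"
    by (rule of_real_eq_iff[THEN iffD1])
  then show ?thesis
    by (simp add: power2_eq_iff_nonneg)
qed

lemma cinner_Cauchy_Schwarz: "cmod (cinner x y) \<le> norm x * norm (y :: 'a::complex_hilbert)"
proof (cases "y = 0")
  case False
  define p where "p = cinner x y"
  define N where "N = (norm y)\<^sup>2"
  have N: "N > 0" using False by (simp add: N_def)
  define c where "c = - p / complex_of_real N"
  have "complex_of_real ((norm (x + c *\<^sub>C y))\<^sup>2)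
      = cinner x x + cnj c * p + c * cnj p + c * cnj c * complex_of_real N"
    unfolding cinner_self[symmetric] p_def N_def
    using cinner_commute[of y x]
    by (simp only: cinner_add_left cinner_add_right cinner_scaleC_left cinner_scaleC_right)
      (simp add: algebra_simps)
  also have "\<dots> = complex_of_real ((norm x)\<^sup>2) - p * cnj p / complex_of_real N"
    using N by (simp add: c_def field_simps cinner_self)
  also have "\<dots> = complex_of_real ((norm x)\<^sup>2 - (cmod p)\<^sup>2 / N)"
    by (simp add: complex_norm_square[symmetric])
  finally have "(norm (x + c *\<^sub>C y))\<^sup>2 = (norm x)\<^sup>2 - (cmod p)\<^sup>2 / N"
    by (rule of_real_eq_iff[THEN iffD1])
  then have "(cmod p)\<^sup>2 / N \<le> (norm x)\<^sup>2"
    by (metis diff_ge_0_iff_ge zero_le_power2)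
  then have "(cmod p)\<^sup>2 \<le> (norm x * norm y)\<^sup>2"
    using N by (simp add: field_simps power_mult_distrib N_def)
  then show ?thesis
    unfolding p_def by (rule power2_le_imp_le) simp
qed simp

instantiation complex :: complex_hilbert
begin
definition scaleC_complex :: "complex \<Rightarrow> complex \<Rightarrow> complex"
  where "scaleC_complex c z = c * z"
definition cinner_complex :: "complex \<Rightarrow> complex \<Rightarrow> complex"
  where "cinner_complex z w = z * cnj w"
instance
  by standard (auto simp: scaleC_complex_def cinner_complex_def scaleR_conv_of_real algebra_simps
      simp flip: complex_norm_square)
end


section \<open>Bounded operators\<close>

definition bounded_clinear :: "('a::complex_hilbert \<Rightarrow> 'b::complex_hilbert) \<Rightarrow> bool"
  where "bounded_clinear A \<longleftrightarrow>
    Vector_Spaces.linear (*\<^sub>C) (*\<^sub>C) A \<and> (\<exists>K. \<forall>x. norm (A x) \<le> K * norm x)"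

definition cadjoint :: "('a::complex_hilbert \<Rightarrow> 'b::complex_hilbert) \<Rightarrow> 'b \<Rightarrow> 'a"
  where "cadjoint A =
    (THE B. bounded_clinear B \<and> (\<forall>x y. cinner (A x) y = cinner x (B y)))"

definition positive_op :: "('a::complex_hilbert \<Rightarrow> 'a) \<Rightarrow> bool"
  where "positive_op A \<longleftrightarrow> bounded_clinear A \<and> (\<forall>x. cinner (A x) x \<in> \<real>\<^sub>\<ge>\<^sub>0)"

definition sqrt_op :: "('a::complex_hilbert \<Rightarrow> 'a) \<Rightarrow> 'a \<Rightarrow> 'a"
  where "sqrt_op A = (THE R. positive_op R \<and> R \<circ> R = A)"

definition is_isometry :: "('a::complex_hilbert \<Rightarrow> 'b::complex_hilbert) \<Rightarrow> bool"
  where "is_isometry A \<longleftrightarrow> bounded_clinear A \<and> (\<forall>x. norm (A x) = norm x)"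

text \<open>A series of operators, over an arbitrary index set, converges to \<open>S\<close> in the weak operator
  topology if the net of its finite partial sums does.\<close>

definition wot_has_sum ::
    "('i \<Rightarrow> 'a::complex_hilbert \<Rightarrow> 'b::complex_hilbert) \<Rightarrow> ('a \<Rightarrow> 'b) \<Rightarrow> 'i set \<Rightarrow> bool"
  where "wot_has_sum A S I \<longleftrightarrow> bounded_clinear S \<and>
    (\<forall>x y. ((\<lambda>F. cinner (\<Sum>i\<in>F. A i x) y) \<longlongrightarrow> cinner (S x) y) (finite_subsets_at_top I))"

definition wot_summable ::
    "('i \<Rightarrow> 'a::complex_hilbert \<Rightarrow> 'b::complex_hilbert) \<Rightarrow> 'i set \<Rightarrow> bool"
  where "wot_summable A I \<longleftrightarrow> (\<exists>S. wot_has_sum A S I)"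

text \<open>Hilbert spaces that are quantified existentially are represented as closed subspaces of an
  ambient Hilbert space type.\<close>

definition hilbert_subspace :: "'a::complex_hilbert set \<Rightarrow> bool"
  where "hilbert_subspace E \<longleftrightarrow> csubspace E \<and> closed E"


section \<open>Square-summable families\<close>

typedef (overloaded) ('i, 'e) ell2 =
    "{f :: 'i \<Rightarrow> 'e::complex_hilbert. (\<lambda>i. (norm (f i))\<^sup>2) summable_on UNIV}"
  morphisms ell2_nth Abs_ell2
  by (rule exI[of _ "\<lambda>_. 0"]) simp

setup_lifting type_definition_ell2

lemma square_summable_iff:
  fixes f :: "'i \<Rightarrow> 'e::real_normed_vector"
  shows "(\<lambda>i. (norm (f i))\<^sup>2) summable_on UNIV \<longleftrightarrow>
    (\<exists>M. \<forall>F. finite F \<longrightarrow> L2_set (\<lambda>i. norm (f i)) F \<le> M)"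
proof
  assume s: "(\<lambda>i. (norm (f i))\<^sup>2) summable_on UNIV"
  have "L2_set (\<lambda>i. norm (f i)) F \<le> sqrt (\<Sum>\<^sub>\<infinity>i. (norm (f i))\<^sup>2)" if "finite F" for F
    unfolding L2_set_def using finite_sum_le_infsum[OF s that] by simp
  then show "\<exists>M. \<forall>F. finite F \<longrightarrow> L2_set (\<lambda>i. norm (f i)) F \<le> M" by blast
next
  assume "\<exists>M. \<forall>F. finite F \<longrightarrow> L2_set (\<lambda>i. norm (f i)) F \<le> M"
  then obtain M where M: "\<And>F. finite F \<Longrightarrow> L2_set (\<lambda>i. norm (f i)) F \<le> M" by blast
  have "(\<Sum>i\<in>F. (norm (f i))\<^sup>2) \<le> M\<^sup>2" if "finite F" for F
  proof -
    have "(\<Sum>i\<in>F. (norm (f i))\<^sup>2) = (L2_set (\<lambda>i. norm (f i)) F)\<^sup>2"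
      by (simp add: L2_set_def sum_nonneg)
    also have "\<dots> \<le> M\<^sup>2" using M[OF that] by (intro power_mono) auto
    finally show ?thesis .
  qed
  then show "(\<lambda>i. (norm (f i))\<^sup>2) summable_on UNIV"
    by (intro nonneg_bdd_above_summable_on bdd_aboveI2[where M = "M\<^sup>2"]) auto
qed

lemma square_summable_add:
  fixes f g :: "'i \<Rightarrow> 'e::real_normed_vector"
  assumes "(\<lambda>i. (norm (f i))\<^sup>2) summable_on UNIV" "(\<lambda>i. (norm (g i))\<^sup>2) summable_on UNIV"
  shows "(\<lambda>i. (norm (f i + g i))\<^sup>2) summable_on UNIV"
proof -
  obtain M N where "\<And>F. finite F \<Longrightarrow> L2_set (\<lambda>i. norm (f i)) F \<le> M"
      "\<And>F. finite F \<Longrightarrow> L2_set (\<lambda>i. norm (g i)) F \<le> N"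
    using assms unfolding square_summable_iff by blast
  moreover have "L2_set (\<lambda>i. norm (f i + g i)) F
      \<le> L2_set (\<lambda>i. norm (f i)) F + L2_set (\<lambda>i. norm (g i)) F" for F
    by (rule order_trans[OF L2_set_mono L2_set_triangle_ineq]) (auto intro: norm_triangle_ineq)
  ultimately have "\<forall>F. finite F \<longrightarrow> L2_set (\<lambda>i. norm (f i + g i)) F \<le> M + N"
    by (meson add_mono order_trans)
  then show ?thesis unfolding square_summable_iff by blast
qed

lemma square_summable_scaleC:
  fixes f :: "'i \<Rightarrow> 'e::complex_hilbert"
  assumes "(\<lambda>i. (norm (f i))\<^sup>2) summable_on UNIV"
  shows "(\<lambda>i. (norm (c *\<^sub>C f i))\<^sup>2) summable_on UNIV"
  using summable_on_cmult_right[OF assms, of "(cmod c)\<^sup>2"] by (simp add: norm_scaleC power_mult_distrib)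

lemma square_summable_scaleR:
  fixes f :: "'i \<Rightarrow> 'e::real_normed_vector"
  assumes "(\<lambda>i. (norm (f i))\<^sup>2) summable_on UNIV"
  shows "(\<lambda>i. (norm (r *\<^sub>R f i))\<^sup>2) summable_on UNIV"
  using summable_on_cmult_right[OF assms, of "r\<^sup>2"] by (simp add: power_mult_distrib)

lemma square_summable_cinner:
  fixes f g :: "'i \<Rightarrow> 'e::complex_hilbert"
  assumes "(\<lambda>i. (norm (f i))\<^sup>2) summable_on UNIV" "(\<lambda>i. (norm (g i))\<^sup>2) summable_on UNIV"
  shows "(\<lambda>i. cinner (f i) (g i)) summable_on UNIV"
proof -
  have "(\<lambda>i. norm ((norm (f i))\<^sup>2 + (norm (g i))\<^sup>2)) summable_on UNIV"
    using summable_on_add[OF assms] by simp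
  moreover have "cmod (cinner (f i) (g i)) \<le> norm ((norm (f i))\<^sup>2 + (norm (g i))\<^sup>2)" for i
  proof -
    have "cmod (cinner (f i) (g i)) \<le> norm (f i) * norm (g i)"
      by (rule cinner_Cauchy_Schwarz)
    also have "\<dots> \<le> 2 * norm (f i) * norm (g i)" by simp
    also have "\<dots> \<le> (norm (f i))\<^sup>2 + (norm (g i))\<^sup>2" by (rule sum_squares_bound)
    finally show ?thesis by simp
  qed
  ultimately have "(\<lambda>i. cmod (cinner (f i) (g i))) summable_on UNIV"
    by (rule Infinite_Sum.abs_summable_on_comparison_test)
  then show ?thesis by (rule abs_summable_summable)
qed

lemma square_summable_ell2_nth: "(\<lambda>i. (norm (ell2_nth f i))\<^sup>2) summable_on UNIV"
  using ell2_nth by blast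

instantiation ell2 :: (type, complex_hilbert) real_normed_vector
begin

lift_definition zero_ell2 :: "('a, 'b) ell2" is "\<lambda>_. 0" by simp
lift_definition plus_ell2 :: "('a, 'b) ell2 \<Rightarrow> ('a, 'b) ell2 \<Rightarrow> ('a, 'b) ell2"
  is "\<lambda>f g i. f i + g i" by (rule square_summable_add)
lift_definition uminus_ell2 :: "('a, 'b) ell2 \<Rightarrow> ('a, 'b) ell2"
  is "\<lambda>f i. - f i" by simp
lift_definition minus_ell2 :: "('a, 'b) ell2 \<Rightarrow> ('a, 'b) ell2 \<Rightarrow> ('a, 'b) ell2"
  is "\<lambda>f g i. f i - g i"
  using square_summable_add[of _ "\<lambda>i. - _ i"] by (simp add: square_summable_iff)
lift_definition scaleR_ell2 :: "real \<Rightarrow> ('a, 'b) ell2 \<Rightarrow> ('a, 'b) ell2"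
  is "\<lambda>r f i. r *\<^sub>R f i" by (rule square_summable_scaleR)
definition norm_ell2 :: "('a, 'b) ell2 \<Rightarrow> real"
  where "norm_ell2 f = sqrt (\<Sum>\<^sub>\<infinity>i. (norm (ell2_nth f i))\<^sup>2)"
definition dist_ell2 :: "('a, 'b) ell2 \<Rightarrow> ('a, 'b) ell2 \<Rightarrow> real"
  where "dist_ell2 f g = norm (f - g)"
definition sgn_ell2 :: "('a, 'b) ell2 \<Rightarrow> ('a, 'b) ell2"
  where "sgn_ell2 f = inverse (norm f) *\<^sub>R f"
definition uniformity_ell2 :: "(('a, 'b) ell2 \<times> ('a, 'b) ell2) filter"
  where "uniformity_ell2 = (INF e\<in>{0<..}. principal {(f, g). dist f g < e})"
definition open_ell2 :: "('a, 'b) ell2 set \<Rightarrow> bool"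
  where "open_ell2 U = (\<forall>x\<in>U. \<forall>\<^sub>F (x', y) in uniformity. x' = x \<longrightarrow> y \<in> U)"

lemma L2_set_le_norm_ell2: "finite F \<Longrightarrow> L2_set (\<lambda>i. norm (ell2_nth f i)) F \<le> norm f"
  unfolding L2_set_def norm_ell2_def
  by (simp add: finite_sum_le_infsum square_summable_ell2_nth)

lemma norm_ell2_leI:
  assumes "\<And>F. finite F \<Longrightarrow> L2_set (\<lambda>i. norm (ell2_nth f i)) F \<le> M"
  shows "norm f \<le> M"
proof -
  have M: "0 \<le> M" using assms[of "{}"] by simp
  have "(\<Sum>i\<in>F. (norm (ell2_nth f i))\<^sup>2) \<le> M\<^sup>2" if "finite F" for F
    using assms[OF that] M unfolding L2_set_def by (metis real_sqrt_le_iff real_sqrt_unique)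
  then have "(\<Sum>\<^sub>\<infinity>i. (norm (ell2_nth f i))\<^sup>2) \<le> M\<^sup>2"
    by (intro infsum_le_finite_sums square_summable_ell2_nth) auto
  then show ?thesis unfolding norm_ell2_def using M real_le_lsqrt by blast
qed

lemma norm_ell2_nth_le: "norm (ell2_nth f i) \<le> norm f"
  using L2_set_le_norm_ell2[of "{i}" f] by simp

instance
proof
  fix f g h :: "('a, 'b) ell2" and r s :: real
  show "f + g + h = f + (g + h)" "f + g = g + f" "0 + f = f" "- f + f = 0" "f - g = f + - g"
    "r *\<^sub>R (f + g) = r *\<^sub>R f + r *\<^sub>R g" "(r + s) *\<^sub>R f = r *\<^sub>R f + s *\<^sub>R f"
    "r *\<^sub>R s *\<^sub>R f = (r * s) *\<^sub>R f" "1 *\<^sub>R f = f"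
    by (transfer; simp add: algebra_simps)+
  show "dist f g = norm (f - g)" by (rule dist_ell2_def)
  show "sgn f = inverse (norm f) *\<^sub>R f" by (rule sgn_ell2_def)
  show "uniformity = (INF e\<in>{0<..}. principal {(x, y). dist x (y :: ('a, 'b) ell2) < e})"
    by (rule uniformity_ell2_def)
  show "open U = (\<forall>x\<in>U. \<forall>\<^sub>F (x', y) in uniformity. x' = x \<longrightarrow> y \<in> U)"
    for U :: "('a, 'b) ell2 set" by (rule open_ell2_def)
  show "norm f = 0 \<longleftrightarrow> f = 0"
  proof
    assume "norm f = 0"
    then have "ell2_nth f i = 0" for i using norm_ell2_nth_le[of f i] by simp
    then show "f = 0" by (transfer) auto
  next
    assume "f = 0" then show "norm f = 0" unfolding norm_ell2_def by (simp add: zero_ell2.rep_eq)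
  qed
  show "norm (f + g) \<le> norm f + norm g"
  proof (rule norm_ell2_leI)
    fix F :: "'a set" assume F: "finite F"
    have "L2_set (\<lambda>i. norm (ell2_nth (f + g) i)) F
        \<le> L2_set (\<lambda>i. norm (ell2_nth f i) + norm (ell2_nth g i)) F"
      by (rule L2_set_mono) (auto simp: plus_ell2.rep_eq intro: norm_triangle_ineq)
    also have "\<dots> \<le> L2_set (\<lambda>i. norm (ell2_nth f i)) F + L2_set (\<lambda>i. norm (ell2_nth g i)) F"
      by (rule L2_set_triangle_ineq)
    also have "\<dots> \<le> norm f + norm g" by (intro add_mono L2_set_le_norm_ell2 F)
    finally show "L2_set (\<lambda>i. norm (ell2_nth (f + g) i)) F \<le> norm f + norm g" .
  qed
  show "norm (r *\<^sub>R f) = \<bar>r\<bar> * norm f"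
    unfolding norm_ell2_def
    by (simp add: scaleR_ell2.rep_eq power_mult_distrib infsum_cmult_right' real_sqrt_mult)
qed

end

lemma L2_set_diff_le_norm_ell2:
  "L2_set (\<lambda>i. norm (ell2_nth f i - ell2_nth g i)) F \<le> norm (f - g)" if "finite F"
  using L2_set_le_norm_ell2[OF that, of "f - g"] by (simp add: minus_ell2.rep_eq)

instance ell2 :: (type, complex_hilbert) banach
proof
  fix X :: "nat \<Rightarrow> ('a, 'b) ell2"
  assume X: "Cauchy X"
  have "Cauchy (\<lambda>n. ell2_nth (X n) i)" for i
  proof (rule CauchyI)
    fix e :: real assume "e > 0"
    then obtain M where M: "\<And>m n. m \<ge> M \<Longrightarrow> n \<ge> M \<Longrightarrow> norm (X m - X n) < e"
      using metric_CauchyD[OF X \<open>e > 0\<close>] unfolding dist_norm by blast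
    have "norm (ell2_nth (X m) i - ell2_nth (X n) i) < e" if "m \<ge> M" "n \<ge> M" for m n
      using norm_ell2_nth_le[of "X m - X n" i] M[OF that] by (simp add: minus_ell2.rep_eq)
    then show "\<exists>M. \<forall>m\<ge>M. \<forall>n\<ge>M. norm (ell2_nth (X m) i - ell2_nth (X n) i) < e" by blast
  qed
  then have "\<exists>l. (\<lambda>n. ell2_nth (X n) i) \<longlonglongrightarrow> l" for i
    by (simp add: Cauchy_convergent_iff convergent_def)
  then obtain l where l: "\<And>i. (\<lambda>n. ell2_nth (X n) i) \<longlonglongrightarrow> l i" by metis
  have bound: "\<exists>M. \<forall>m\<ge>M. \<forall>F. finite F \<longrightarrow> L2_set (\<lambda>i. norm (ell2_nth (X m) i - l i)) F \<le> e"
    if "e > 0" for e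
  proof -
    obtain M where M: "\<And>m n. m \<ge> M \<Longrightarrow> n \<ge> M \<Longrightarrow> norm (X m - X n) < e"
      using metric_CauchyD[OF X \<open>e > 0\<close>] unfolding dist_norm by blast
    have "L2_set (\<lambda>i. norm (ell2_nth (X m) i - l i)) F \<le> e" if "m \<ge> M" "finite F" for m F
    proof (rule LIMSEQ_le_const2)
      show "(\<lambda>n. L2_set (\<lambda>i. norm (ell2_nth (X m) i - ell2_nth (X n) i)) F)
          \<longlonglongrightarrow> L2_set (\<lambda>i. norm (ell2_nth (X m) i - l i)) F"
        unfolding L2_set_def by (intro tendsto_intros l)
      have "L2_set (\<lambda>i. norm (ell2_nth (X m) i - ell2_nth (X n) i)) F \<le> e" if "n \<ge> M" for n
        using L2_set_diff_le_norm_ell2[OF \<open>finite F\<close>, of "X m" "X n"] M[OF \<open>m \<ge> M\<close> that] by linarith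
      then show "\<exists>N. \<forall>n\<ge>N. L2_set (\<lambda>i. norm (ell2_nth (X m) i - ell2_nth (X n) i)) F \<le> e"
        by blast
    qed
    then show ?thesis by blast
  qed
  obtain M where M: "\<And>F. finite F \<Longrightarrow> L2_set (\<lambda>i. norm (ell2_nth (X M) i - l i)) F \<le> 1"
    using bound[of 1] by auto
  have "(\<lambda>i. (norm (ell2_nth (X M) i - l i))\<^sup>2) summable_on UNIV"
    unfolding square_summable_iff using M by blast
  then have "(\<lambda>i. (norm (- (ell2_nth (X M) i - l i)))\<^sup>2) summable_on UNIV"
    by (simp only: norm_minus_cancel)
  from square_summable_add[OF square_summable_ell2_nth[of "X M"] this]
  have "(\<lambda>i. (norm (l i))\<^sup>2) summable_on UNIV" by simp
  then obtain L where L: "ell2_nth L = l"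
    using Abs_ell2_inverse by blast
  have "X \<longlonglongrightarrow> L"
  proof (rule LIMSEQ_I)
    fix e :: real assume "e > 0"
    then obtain M where M: "\<And>m F. m \<ge> M \<Longrightarrow> finite F \<Longrightarrow>
        L2_set (\<lambda>i. norm (ell2_nth (X m) i - l i)) F \<le> e / 2"
      using bound[of "e / 2"] by auto
    have "norm (X m - L) \<le> e / 2" if "m \<ge> M" for m
      using M[OF that] by (intro norm_ell2_leI) (simp add: minus_ell2.rep_eq L)
    then show "\<exists>M. \<forall>m\<ge>M. norm (X m - L) < e"
      using \<open>e > 0\<close> by (intro exI[of _ M]) fastforce
  qed
  then show "convergent X" by (auto simp: convergent_def)
qed

instantiation ell2 :: (type, complex_hilbert) complex_hilbert
begin
lift_definition scaleC_ell2 :: "complex \<Rightarrow> ('a, 'b) ell2 \<Rightarrow> ('a, 'b) ell2"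
  is "\<lambda>c f i. c *\<^sub>C f i" by (rule square_summable_scaleC)
definition cinner_ell2 :: "('a, 'b) ell2 \<Rightarrow> ('a, 'b) ell2 \<Rightarrow> complex"
  where "cinner_ell2 f g = (\<Sum>\<^sub>\<infinity>i. cinner (ell2_nth f i) (ell2_nth g i))"
instance
proof
  fix f g h :: "('a, 'b) ell2" and r :: real and c d :: complex
  show "complex_of_real r *\<^sub>C f = r *\<^sub>R f" "c *\<^sub>C (f + g) = c *\<^sub>C f + c *\<^sub>C g"
    "(c + d) *\<^sub>C f = c *\<^sub>C f + d *\<^sub>C f" "c *\<^sub>C d *\<^sub>C f = (c * d) *\<^sub>C f"
    by (transfer; simp add: scaleC_of_real scaleC_add_right scaleC_add_left scaleC_scaleC)+
  show "cinner (f + g) h = cinner f h + cinner g h"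
    unfolding cinner_ell2_def
    by (simp add: plus_ell2.rep_eq cinner_add_left infsum_add square_summable_cinner
        square_summable_ell2_nth)
  show "cinner (c *\<^sub>C f) g = c * cinner f g"
    unfolding cinner_ell2_def
    by (simp add: scaleC_ell2.rep_eq cinner_scaleC_left infsum_cmult_right')
  show "cinner f g = cnj (cinner g f)"
    unfolding cinner_ell2_def by (subst cinner_commute) (simp flip: infsum_cnj)
  have "cinner f f = (\<Sum>\<^sub>\<infinity>i. complex_of_real ((norm (ell2_nth f i))\<^sup>2))"
    unfolding cinner_ell2_def by (simp add: cinner_self)
  also have "\<dots> = complex_of_real (\<Sum>\<^sub>\<infinity>i. (norm (ell2_nth f i))\<^sup>2)"
    by (intro infsumI has_sum_of_real has_sum_infsum square_summable_ell2_nth)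
  finally show "cinner f f = complex_of_real ((norm f)\<^sup>2)"
    unfolding norm_ell2_def by (simp add: infsum_nonneg)
qed
end


section \<open>The full Fock space and its tensor products\<close>

text \<open>The free semigroup on the generators \<open>'n\<close> is \<open>'n list\<close>, with \<open>[]\<close> as identity and \<open>i # \<alpha>\<close> as the
  product of the generator \<open>i\<close> with \<open>\<alpha>\<close>. The \<open>k\<close>-th tensor power of an \<open>n\<close>-dimensional Hilbert
  space with orthonormal basis \<open>'n\<close> has as its orthonormal basis the words of length \<open>k\<close>, so that
  the direct sum of all these powers consists of the square-summable families over \<open>'n list\<close>.\<close>

type_synonym 'n fock = "('n list, complex) ell2"

lift_definition fock_basis :: "'n list \<Rightarrow> 'n fock"  (\<open>\<e>\<close>)
  is "\<lambda>\<alpha> \<beta>. if \<beta> = \<alpha> then 1 else 0"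
proof -
  fix \<alpha> :: "'n list"
  have "((\<lambda>\<beta>. (cmod (if \<beta> = \<alpha> then 1 else 0))\<^sup>2) summable_on UNIV) \<longleftrightarrow>
      ((\<lambda>\<beta>. (cmod (if \<beta> = \<alpha> then 1 else 0))\<^sup>2) summable_on {\<alpha>})"
    by (rule summable_on_cong_neutral) auto
  then show "(\<lambda>\<beta>. (cmod (if \<beta> = \<alpha> then 1 else 0))\<^sup>2) summable_on UNIV" by simp
qed

text \<open>The Hilbert tensor product of the Fock space with \<open>'e\<close> is \<open>('n list, 'e) ell2\<close>, with the
  following elementary tensors. The lemmas \<open>cinner_tensor\<close> and \<open>closure_cspan_tensor\<close> below show
  that it has the properties that characterize the Hilbert tensor product.\<close>

lift_definition tensor :: "('i, complex) ell2 \<Rightarrow> 'e::complex_hilbert \<Rightarrow> ('i, 'e) ell2"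
    (infixr "\<otimes>" 70)
  is "\<lambda>f x i. f i *\<^sub>C x"
proof -
  fix f :: "'i \<Rightarrow> complex" and x :: 'e
  assume "(\<lambda>i. (cmod (f i))\<^sup>2) summable_on UNIV"
  from summable_on_cmult_left[OF this, of "(norm x)\<^sup>2"]
  show "(\<lambda>i. (norm (f i *\<^sub>C x))\<^sup>2) summable_on UNIV"
    by (simp add: norm_scaleC power_mult_distrib)
qed

definition fock_tensor :: "'e::complex_hilbert set \<Rightarrow> ('n list, 'e) ell2 set"
  where "fock_tensor E = closure (cspan {f \<otimes> x | f x. x \<in> E})"

text \<open>The operator \<open>A \<otimes> I\<close>. Its restriction to \<open>fock_tensor E\<close> is \<open>A \<otimes> I\<^sub>E\<close>.\<close>

definition tensor_id :: "('n fock \<Rightarrow> 'n fock) \<Rightarrow> ('n list, 'e::complex_hilbert) ell2 \<Rightarrow> ('n list, 'e) ell2"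
  where "tensor_id A = (THE B. bounded_clinear B \<and> (\<forall>f x. B (f \<otimes> x) = A f \<otimes> x))"

lemma cinner_tensor: "cinner (f \<otimes> x) (g \<otimes> y) = cinner f g * cinner x y"
  unfolding cinner_ell2_def
  by (simp add: tensor.rep_eq cinner_scaleC_left cinner_scaleC_right cinner_complex_def
      infsum_cmult_right' flip: infsum_cmult_left') (simp add: mult_ac)

lemma has_sum_fock_basis_tensor:
  fixes u :: "('n list, 'e::complex_hilbert) ell2"
  shows "((\<lambda>\<alpha>. \<e> \<alpha> \<otimes> ell2_nth u \<alpha>) has_sum u) UNIV"
proof -
  define s where "s F = (\<Sum>\<alpha>\<in>F. \<e> \<alpha> \<otimes> ell2_nth u \<alpha>)" for F :: "'n list set"
  have nth_s: "ell2_nth (s F) \<beta> = (if \<beta> \<in> F then ell2_nth u \<beta> else 0)" if "finite F" for F \<beta>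
    using that unfolding s_def
    by (induction F rule: finite_induct)
      (auto simp: zero_ell2.rep_eq plus_ell2.rep_eq tensor.rep_eq fock_basis.rep_eq scaleC_one)
  have norm_s: "norm (s F - u) = sqrt ((norm u)\<^sup>2 - (\<Sum>\<alpha>\<in>F. (norm (ell2_nth u \<alpha>))\<^sup>2))"
    if F: "finite F" for F
  proof -
    have "(\<Sum>\<^sub>\<infinity>\<beta>. (norm (ell2_nth (s F - u) \<beta>))\<^sup>2) = (\<Sum>\<^sub>\<infinity>\<beta>\<in>UNIV - F. (norm (ell2_nth u \<beta>))\<^sup>2)"
      by (rule infsum_cong_neutral) (auto simp: minus_ell2.rep_eq nth_s[OF F])
    also have "\<dots> = (\<Sum>\<^sub>\<infinity>\<beta>. (norm (ell2_nth u \<beta>))\<^sup>2) - (\<Sum>\<^sub>\<infinity>\<beta>\<in>F. (norm (ell2_nth u \<beta>))\<^sup>2)"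
      by (intro infsum_Diff square_summable_ell2_nth) (use F in auto)
    also have "\<dots> = (norm u)\<^sup>2 - (\<Sum>\<alpha>\<in>F. (norm (ell2_nth u \<alpha>))\<^sup>2)"
      using F by (simp add: norm_ell2_def infsum_nonneg)
    finally show ?thesis by (simp add: norm_ell2_def[of "s F - u"])
  qed
  have "((\<lambda>F. \<Sum>\<alpha>\<in>F. (norm (ell2_nth u \<alpha>))\<^sup>2) \<longlongrightarrow> (norm u)\<^sup>2) (finite_subsets_at_top UNIV)"
    using has_sum_infsum[OF square_summable_ell2_nth[of u]]
    by (simp add: has_sum_def norm_ell2_def infsum_nonneg)
  then have "((\<lambda>F. sqrt ((norm u)\<^sup>2 - (\<Sum>\<alpha>\<in>F. (norm (ell2_nth u \<alpha>))\<^sup>2)))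
      \<longlongrightarrow> sqrt ((norm u)\<^sup>2 - (norm u)\<^sup>2)) (finite_subsets_at_top UNIV)"
    by (rule tendsto_real_sqrt[OF tendsto_diff[OF tendsto_const]])
  then have "((\<lambda>F. sqrt ((norm u)\<^sup>2 - (\<Sum>\<alpha>\<in>F. (norm (ell2_nth u \<alpha>))\<^sup>2))) \<longlongrightarrow> 0)
      (finite_subsets_at_top UNIV)" by simp
  then have "((\<lambda>F. norm (s F - u)) \<longlongrightarrow> 0) (finite_subsets_at_top UNIV)"
  proof (rule Lim_transform_eventually)
    show "\<forall>\<^sub>F F in finite_subsets_at_top UNIV.
        sqrt ((norm u)\<^sup>2 - (\<Sum>\<alpha>\<in>F. (norm (ell2_nth u \<alpha>))\<^sup>2)) = norm (s F - u)"
      by (rule eventually_finite_subsets_at_top_weakI) (simp only: norm_s)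
  qed
  then have "(s \<longlongrightarrow> u) (finite_subsets_at_top UNIV)"
    by (rule LIM_zero_cancel[OF tendsto_norm_zero_cancel])
  then show ?thesis by (simp add: has_sum_def s_def[abs_def])
qed

lemma closure_cspan_tensor: "fock_tensor (UNIV :: 'e::complex_hilbert set) = (UNIV :: ('n list, 'e) ell2 set)"
proof -
  have "u \<in> fock_tensor UNIV" for u :: "('n list, 'e) ell2"
    unfolding fock_tensor_def
  proof (rule Lim_in_closed_set[OF closed_closure])
    show "((\<lambda>F. \<Sum>\<alpha>\<in>F. \<e> \<alpha> \<otimes> ell2_nth u \<alpha>) \<longlongrightarrow> u) (finite_subsets_at_top UNIV)"
      using has_sum_fock_basis_tensor[of u] by (simp add: has_sum_def)
    show "\<forall>\<^sub>F F in finite_subsets_at_top UNIV.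
        (\<Sum>\<alpha>\<in>F. \<e> \<alpha> \<otimes> ell2_nth u \<alpha>) \<in> closure (cspan {f \<otimes> x | f x. x \<in> UNIV})"
      by (intro always_eventually allI subsetD[OF closure_subset] complex_vector.span_sum
          complex_vector.span_base) auto
  qed simp
  then show ?thesis by blast
qed


section \<open>Weighted left creation operators and models\<close>

definition weighted_creation :: "('n list \<Rightarrow> real) \<Rightarrow> 'n \<Rightarrow> 'n fock \<Rightarrow> 'n fock"
  where "weighted_creation b i = (THE W. bounded_clinear W \<and>
    (\<forall>\<alpha>. W (\<e> \<alpha>) = sqrt (b \<alpha> / b (i # \<alpha>)) *\<^sub>R \<e> (i # \<alpha>)))"

fun word_op :: "('n \<Rightarrow> 'h \<Rightarrow> 'h) \<Rightarrow> 'n list \<Rightarrow> 'h \<Rightarrow> 'h"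
  where "word_op T [] = id"
  | "word_op T (i # \<alpha>) = T i \<circ> word_op T \<alpha>"

text \<open>The summands \<open>b\<^sub>\<alpha> T\<^sub>\<alpha> Q T\<^sub>\<alpha>\<^sup>*\<close>.\<close>

definition weighted_term ::
    "('n list \<Rightarrow> real) \<Rightarrow> ('n \<Rightarrow> 'h::complex_hilbert \<Rightarrow> 'h) \<Rightarrow> ('h \<Rightarrow> 'h) \<Rightarrow> 'n list \<Rightarrow> 'h \<Rightarrow> 'h"
  where "weighted_term b T Q \<alpha> h = b \<alpha> *\<^sub>R word_op T \<alpha> (Q (cadjoint (word_op T \<alpha>) h))"

definition intertwines ::
    "('n list \<Rightarrow> real) \<Rightarrow> ('n \<Rightarrow> 'h::complex_hilbert \<Rightarrow> 'h) \<Rightarrow> 'e::complex_hilbert set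
      \<Rightarrow> ('h \<Rightarrow> ('n list, 'e) ell2) \<Rightarrow> bool"
  where "intertwines b T E V \<longleftrightarrow> bounded_clinear V \<and> range V \<subseteq> fock_tensor E \<and>
    (\<forall>i. V \<circ> cadjoint (T i) = tensor_id (cadjoint (weighted_creation b i)) \<circ> V)"

text \<open>In the next two conditions \<open>E\<close> runs through all Hilbert spaces inside \<open>'e\<close>, including \<open>'e\<close> itself.
  An existential quantifier over all Hilbert spaces is not available in HOL; instead one asserts that
  the conditions imply other properties for arbitrary \<open>'e\<close>, and that they follow from other properties
  for \<open>'e = 'h\<close>. In the first condition \<open>V\<close> has to be nonzero: the zero operator intertwines everything.\<close>

definition has_intertwiner :: "('n list \<Rightarrow> real) \<Rightarrow> ('n \<Rightarrow> 'h::complex_hilbert \<Rightarrow> 'h)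
    \<Rightarrow> 'e::complex_hilbert itself \<Rightarrow> bool"
  where "has_intertwiner b T _ \<longleftrightarrow>
    (\<exists>(E :: 'e set) V. hilbert_subspace E \<and> intertwines b T E V \<and> V \<noteq> (\<lambda>_. 0))"

definition has_factored_series :: "('n list \<Rightarrow> real) \<Rightarrow> ('n \<Rightarrow> 'h::complex_hilbert \<Rightarrow> 'h)
    \<Rightarrow> 'e::complex_hilbert itself \<Rightarrow> bool"
  where "has_factored_series b T _ \<longleftrightarrow>
    (\<exists>(E :: 'e set) (\<Theta> :: 'h \<Rightarrow> 'e). hilbert_subspace E \<and> bounded_clinear \<Theta> \<and> range \<Theta> \<subseteq> E \<and>
      \<Theta> \<noteq> (\<lambda>_. 0) \<and> wot_summable (weighted_term b T (cadjoint \<Theta> \<circ> \<Theta>)) UNIV)"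

text \<open>The operator \<open>D\<close> has to be nonzero as well, the series being trivial for \<open>D = 0\<close>.\<close>

definition has_positive_series :: "('n list \<Rightarrow> real) \<Rightarrow> ('n \<Rightarrow> 'h::complex_hilbert \<Rightarrow> 'h) \<Rightarrow> bool"
  where "has_positive_series b T \<longleftrightarrow>
    (\<exists>D. positive_op D \<and> D \<noteq> (\<lambda>_. 0) \<and> wot_summable (weighted_term b T D) UNIV)"

definition model_summand :: "('n list \<Rightarrow> real) \<Rightarrow> ('n \<Rightarrow> 'h::complex_hilbert \<Rightarrow> 'h) \<Rightarrow> ('h \<Rightarrow> 'h)
    \<Rightarrow> 'h \<Rightarrow> 'n list \<Rightarrow> ('n list, 'h) ell2"
  where "model_summand b T D h \<alpha> =
    sqrt (b \<alpha>) *\<^sub>R (\<e> \<alpha> \<otimes> sqrt_op D (cadjoint (word_op T \<alpha>) h))"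

definition model_map :: "('n list \<Rightarrow> real) \<Rightarrow> ('n \<Rightarrow> 'h::complex_hilbert \<Rightarrow> 'h) \<Rightarrow> ('h \<Rightarrow> 'h)
    \<Rightarrow> 'h \<Rightarrow> ('n list, 'h) ell2"
  where "model_map b T D h = (\<Sum>\<^sub>\<infinity>\<alpha>. model_summand b T D h \<alpha>)"

end

theory Submission
  imports Defs
begin

text \<open>The intertwining relation determines \<open>V\<close> by the operator \<open>\<Theta> = V\<^bsub>[]\<^esub>\<close> that takes \<open>h\<close> to the
  coordinate of \<open>V h\<close> at the empty word: comparing coordinates gives
  \<open>V\<^sub>\<alpha> = sqrt b\<^sub>\<alpha> \<Theta> T\<^sub>\<alpha>\<^sup>*\<close> by induction on the word \<open>\<alpha>\<close>. Hence the partial sums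
  of the series satisfy \<open>\<langle>\<Sum> b\<^sub>\<alpha> T\<^sub>\<alpha> \<Theta>\<^sup>* \<Theta> T\<^sub>\<alpha>\<^sup>* x, y\<rangle> = \<Sum> \<langle>V\<^sub>\<alpha> x, V\<^sub>\<alpha> y\<rangle>\<close>, and weak convergence of the
  series is the same as the existence of the bounded operator \<open>V\<close>; its sum is \<open>V\<^sup>* V\<close>. With
  \<open>\<Theta> = D\<^sup>1\<^sup>/\<^sup>2\<close> this also gives the isometry criterion.\<close>

section \<open>Calculus of the inner product\<close>

lemma cinner_scaleR_left: "cinner (r *\<^sub>R x) y = complex_of_real r * cinner x (y :: 'a::complex_hilbert)"
  by (metis cinner_scaleC_left scaleC_of_real)

lemma cinner_scaleR_right: "cinner x (r *\<^sub>R y) = complex_of_real r * cinner x (y :: 'a::complex_hilbert)"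
  using cinner_scaleC_right[of x "complex_of_real r" y] by (simp add: scaleC_of_real)

lemma cinner_minus_left: "cinner (- x) y = - cinner x (y :: 'a::complex_hilbert)"
  using cinner_scaleR_left[of "-1" x y] by simp

lemma cinner_minus_right: "cinner x (- y) = - cinner x (y :: 'a::complex_hilbert)"
  using cinner_scaleR_right[of x "-1" y] by simp

lemma cinner_diff_left: "cinner (x - y) z = cinner x z - cinner y (z :: 'a::complex_hilbert)"
  using cinner_add_left[of x "- y" z] by (simp add: cinner_minus_left)

lemma cinner_diff_right: "cinner x (y - z) = cinner x y - cinner x (z :: 'a::complex_hilbert)"
  using cinner_add_right[of x y "- z"] by (simp add: cinner_minus_right)

lemmas cinner_simps = cinner_add_left cinner_add_right cinner_diff_left cinner_diff_right
  cinner_minus_left cinner_minus_right cinner_scaleR_left cinner_scaleR_right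
  cinner_scaleC_left cinner_scaleC_right

lemma cinner_sum_left: "cinner (\<Sum>i\<in>F. f i) y = (\<Sum>i\<in>F. cinner (f i) (y :: 'a::complex_hilbert))"
  by (induction F rule: infinite_finite_induct) (auto simp: cinner_add_left)

lemma norm_sq_eq_Re_cinner: "(norm x)\<^sup>2 = Re (cinner x (x :: 'a::complex_hilbert))"
  by (simp add: cinner_self)

lemma Re_cinner_commute: "Re (cinner x y) = Re (cinner y (x :: 'a::complex_hilbert))"
  by (subst cinner_commute) simp

lemma cinner_self_eq_0: "cinner x x = 0 \<longleftrightarrow> x = (0 :: 'a::complex_hilbert)"
  by (simp add: cinner_self)

lemma cinner_ext_right:
  fixes x y :: "'a::complex_hilbert"
  assumes "\<And>z. cinner z x = cinner z y"
  shows "x = y"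
  using assms[of "x - y"] cinner_self_eq_0[of "x - y"] by (simp add: cinner_diff_right)

lemma parallelogram_law:
  fixes x y :: "'a::complex_hilbert"
  shows "(norm (x + y))\<^sup>2 + (norm (x - y))\<^sup>2 = 2 * (norm x)\<^sup>2 + 2 * (norm y)\<^sup>2"
  by (simp add: norm_sq_eq_Re_cinner cinner_simps)

lemma bounded_bilinear_cinner:
  "bounded_bilinear (cinner :: 'a::complex_hilbert \<Rightarrow> 'a \<Rightarrow> complex)"
proof
  show "\<exists>K. \<forall>a b :: 'a. norm (cinner a b) \<le> norm a * norm b * K"
    using cinner_Cauchy_Schwarz by (intro exI[of _ 1]) auto
qed (auto simp: cinner_simps scaleR_conv_of_real)

lemmas tendsto_cinner = bounded_bilinear.tendsto[OF bounded_bilinear_cinner]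

text \<open>Polarization over the complex numbers: the diagonal at x + y shows that B is
  antisymmetric at x and y, the diagonal at i x + y that it is symmetric there. This makes positive
  operators self-adjoint and shows that norm-preserving operators preserve inner products.\<close>

lemma sesquilinear_eq_0:
  fixes B :: "'a::complex_hilbert \<Rightarrow> 'a \<Rightarrow> complex"
  assumes "\<And>x y z. B (x + y) z = B x z + B y z" "\<And>x y z. B x (y + z) = B x y + B x z"
    and "\<And>c x y. B (c *\<^sub>C x) y = c * B x y" "\<And>c x y. B x (c *\<^sub>C y) = cnj c * B x y"
    and diag: "\<And>x. B x x = 0"
  shows "B x y = 0"
proof -
  have 1: "B x y + B y x = 0"
    using diag[of "x + y"] unfolding assms(1,2) by (simp add: diag add.commute)
  have "\<i> * B x y - \<i> * B y x = 0"
    using diag[of "\<i> *\<^sub>C x + y"] unfolding assms(1-4) by (simp add: diag)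
  then have "B x y = B y x"
    by simp
  with 1 show ?thesis by simp
qed

section \<open>Bounded operators\<close>

lemma bounded_clinearI:
  fixes A :: "'a::complex_hilbert \<Rightarrow> 'b::complex_hilbert"
  assumes "\<And>x y. A (x + y) = A x + A y" "\<And>c x. A (c *\<^sub>C x) = c *\<^sub>C A x"
    and "\<And>x. norm (A x) \<le> K * norm x"
  shows "bounded_clinear A"
  unfolding bounded_clinear_def Vector_Spaces.linear_iff
  by (intro conjI allI exI[of _ K] complex_vector.vector_space_axioms assms)

lemma
  fixes A :: "'a::complex_hilbert \<Rightarrow> 'b::complex_hilbert"
  assumes "bounded_clinear A"
  shows bounded_clinear_add: "A (x + y) = A x + A y"
    and bounded_clinear_scaleC: "A (c *\<^sub>C x) = c *\<^sub>C A x"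
  using assms unfolding bounded_clinear_def Vector_Spaces.linear_iff by blast+

lemma bounded_clinear_scaleR:
  fixes A :: "'a::complex_hilbert \<Rightarrow> 'b::complex_hilbert"
  assumes "bounded_clinear A"
  shows "A (r *\<^sub>R x) = r *\<^sub>R A x"
  by (metis assms bounded_clinear_scaleC scaleC_of_real)

lemma bounded_clinear_bound:
  fixes A :: "'a::complex_hilbert \<Rightarrow> 'b::complex_hilbert"
  assumes "bounded_clinear A"
  obtains K where "K > 0" "\<And>x. norm (A x) \<le> K * norm x"
proof -
  obtain K where K: "\<And>x. norm (A x) \<le> K * norm x"
    using assms unfolding bounded_clinear_def by blast
  have "norm (A x) \<le> (\<bar>K\<bar> + 1) * norm x" for x
    by (rule order_trans[OF K]) (auto intro: mult_right_mono)
  then show thesis by (intro that[of "\<bar>K\<bar> + 1"]) auto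
qed

lemma bounded_clinear_imp_bounded_linear:
  fixes A :: "'a::complex_hilbert \<Rightarrow> 'b::complex_hilbert"
  assumes "bounded_clinear A"
  shows "bounded_linear A"
proof -
  obtain K where "\<And>x. norm (A x) \<le> K * norm x"
    using bounded_clinear_bound[OF assms] by blast
  then show ?thesis
    by (intro bounded_linear_intro[where K = K])
      (auto simp: bounded_clinear_add[OF assms] bounded_clinear_scaleR[OF assms] mult.commute)
qed

lemmas bounded_clinear_diff = linear_diff[OF bounded_linear.linear[OF bounded_clinear_imp_bounded_linear]]
lemmas bounded_clinear_zero = linear_0[OF bounded_linear.linear[OF bounded_clinear_imp_bounded_linear]]
lemmas bounded_clinear_tendsto = bounded_linear.tendsto[OF bounded_clinear_imp_bounded_linear]

lemma bounded_clinear_scaleC_right: "bounded_clinear (\<lambda>x :: 'a::complex_hilbert. c *\<^sub>C x)"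
  by (rule bounded_clinearI[where K = "cmod c"])
    (simp_all add: scaleC_add_right scaleC_scaleC norm_scaleC mult.commute)

lemma bounded_clinear_id: "bounded_clinear (id :: 'a::complex_hilbert \<Rightarrow> 'a)"
  by (rule bounded_clinearI[where K = 1]) auto

lemma bounded_clinear_compose:
  fixes A :: "'b::complex_hilbert \<Rightarrow> 'c::complex_hilbert" and B :: "'a::complex_hilbert \<Rightarrow> 'b"
  assumes A: "bounded_clinear A" and B: "bounded_clinear B"
  shows "bounded_clinear (A \<circ> B)"
proof -
  obtain K where K: "K > 0" "\<And>x. norm (A x) \<le> K * norm x"
    using bounded_clinear_bound[OF A] by blast
  obtain L where L: "\<And>x. norm (B x) \<le> L * norm x"
    using bounded_clinear_bound[OF B] by blast
  have "norm (A (B x)) \<le> (K * L) * norm x" for x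
    using order_trans[OF K(2)[of "B x"] mult_left_mono[OF L[of x], of K]] K(1) by (simp add: mult.assoc)
  then show ?thesis
    by (intro bounded_clinearI[where K = "K * L"])
      (auto simp: bounded_clinear_add[OF A] bounded_clinear_add[OF B]
        bounded_clinear_scaleC[OF A] bounded_clinear_scaleC[OF B])
qed

section \<open>Projections and adjoints\<close>

text \<open>The vector \<open>m\<close> is the point of \<open>M\<close> nearest to
  \<open>x\<close>, obtained as the limit of a minimizing sequence. Orthogonality holds because
  moving \<open>m\<close> inside \<open>M\<close> cannot bring it closer to
  \<open>x\<close>.\<close>

lemma closed_csubspace_projection:
  fixes M :: "'a::complex_hilbert set"
  assumes M: "csubspace M" "closed M"
  obtains m where "m \<in> M" "\<And>z. z \<in> M \<Longrightarrow> cinner (x - m) z = 0"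
proof -
  define d where "d = infdist x M"
  have ne: "M \<noteq> {}" using complex_vector.subspace_0[OF M(1)] by blast
  have d_le: "d \<le> norm (x - z)" if "z \<in> M" for z
    using infdist_le[OF that, of x] by (simp add: d_def dist_norm)
  have d0: "d \<ge> 0" by (simp add: d_def infdist_nonneg)
  have "\<exists>z\<in>M. norm (x - z) < d + 1 / Suc n" for n
  proof -
    have "(INF z\<in>M. dist x z) < d + 1 / Suc n" using ne by (simp add: d_def infdist_def)
    then show ?thesis
      using cINF_greatest[OF ne, of "d + 1 / Suc n" "dist x"] unfolding dist_norm by force
  qed
  then obtain s where s: "\<And>n. s n \<in> M" "\<And>n. norm (x - s n) < d + 1 / Suc n" by metis
  have mid: "(1/2) *\<^sub>R (y + z) \<in> M" if "y \<in> M" "z \<in> M" for y z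
    using complex_vector.subspace_scale[OF M(1) complex_vector.subspace_add[OF M(1) that],
        of "complex_of_real (1/2)"] unfolding scaleC_of_real .
  \<comment> \<open>Parallelogram law for \<open>x - s j\<close> and \<open>x - s k\<close>: their
    sum is twice the difference of \<open>x\<close> and a midpoint in \<open>M\<close>, so its norm
    is at least \<open>2 * d\<close>. This makes the minimizing sequence Cauchy.\<close>
  have gap: "(norm (s j - s k))\<^sup>2 \<le> 2 * (norm (x - s j))\<^sup>2 + 2 * (norm (x - s k))\<^sup>2 - 4 * d\<^sup>2" for j k
  proof -
    have "(x - s j) + (x - s k) = 2 *\<^sub>R (x - (1/2) *\<^sub>R (s j + s k))"
      by (simp add: algebra_simps scaleR_2)
    then have "norm ((x - s j) + (x - s k)) = 2 * norm (x - (1/2) *\<^sub>R (s j + s k))" by simp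
    moreover have "d\<^sup>2 \<le> (norm (x - (1/2) *\<^sub>R (s j + s k)))\<^sup>2"
      using d_le[OF mid[OF s(1) s(1)]] d0 by (intro power_mono)
    ultimately have "4 * d\<^sup>2 \<le> (norm ((x - s j) + (x - s k)))\<^sup>2" by (simp add: power_mult_distrib)
    then show ?thesis
      using parallelogram_law[of "x - s j" "x - s k"] by (simp add: norm_minus_commute)
  qed
  have lim: "(\<lambda>n. norm (x - s n)) \<longlonglongrightarrow> d"
  proof (rule tendsto_sandwich[where f = "\<lambda>_. d" and h = "\<lambda>n. d + 1 / Suc n"])
    show "(\<lambda>n. d + 1 / Suc n) \<longlonglongrightarrow> d"
      using tendsto_add[OF tendsto_const[of d] LIMSEQ_inverse_real_of_nat]
      by (simp add: inverse_eq_divide)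
    show "\<forall>\<^sub>F n in sequentially. norm (x - s n) \<le> d + 1 / Suc n"
      using s(2) by (intro always_eventually) (meson less_imp_le)
    show "\<forall>\<^sub>F n in sequentially. d \<le> norm (x - s n)"
      using d_le s(1) by (intro always_eventually) blast
  qed simp
  have "Cauchy s"
  proof (rule CauchyI)
    fix e :: real assume e: "e > 0"
    have "(\<lambda>n. (norm (x - s n))\<^sup>2) \<longlonglongrightarrow> d\<^sup>2" by (intro tendsto_intros lim)
    then have "\<forall>\<^sub>F n in sequentially. (norm (x - s n))\<^sup>2 < d\<^sup>2 + e\<^sup>2 / 4"
      by (rule order_tendstoD(2)) (use e in simp)
    then obtain N where N: "\<And>n. n \<ge> N \<Longrightarrow> (norm (x - s n))\<^sup>2 < d\<^sup>2 + e\<^sup>2 / 4"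
      by (auto simp: eventually_sequentially)
    have "norm (s j - s k) < e" if "j \<ge> N" "k \<ge> N" for j k
    proof (rule power2_less_imp_less)
      show "(norm (s j - s k))\<^sup>2 < e\<^sup>2" using gap[of j k] N[OF that(1)] N[OF that(2)] by linarith
    qed (use e in simp)
    then show "\<exists>N. \<forall>j\<ge>N. \<forall>k\<ge>N. norm (s j - s k) < e" by blast
  qed
  then obtain m where m: "s \<longlonglongrightarrow> m"
    by (auto simp: Cauchy_convergent_iff convergent_def)
  have mM: "m \<in> M"
    using M(2) s(1) m by (metis closed_sequentially)
  have "(\<lambda>n. norm (x - s n)) \<longlonglongrightarrow> norm (x - m)" by (intro tendsto_intros m)
  with lim have dm: "norm (x - m) = d" using LIMSEQ_unique by blast
  show thesis
  proof (rule that[OF mM])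
    fix z assume z: "z \<in> M"
    show "cinner (x - m) z = 0"
    proof (cases "z = 0")
      case False
      define p where "p = cinner (x - m) z"
      define N where "N = (norm z)\<^sup>2"
      have N: "N > 0" using False by (simp add: N_def)
      \<comment> \<open>The coefficient of the projection of \<open>x - m\<close> onto
        \<open>z\<close>: subtracting \<open>c *\<^sub>C z\<close> lowers the squared norm by
        \<open>(cmod p)\<^sup>2 / N\<close>, which minimality forces to be zero.\<close>
      define c where "c = p / complex_of_real N"
      have "m + c *\<^sub>C z \<in> M"
        by (intro complex_vector.subspace_add[OF M(1)] complex_vector.subspace_scale[OF M(1)] mM z)
      from d_le[OF this] have "(norm (x - m))\<^sup>2 \<le> (norm ((x - m) - c *\<^sub>C z))\<^sup>2"
        using dm d0 by (intro power_mono) (auto simp: algebra_simps)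
      also have "\<dots> = Re (complex_of_real ((norm (x - m))\<^sup>2) - cnj c * p - c * cnj p + c * cnj c * complex_of_real N)"
        unfolding norm_sq_eq_Re_cinner[of "x - m - c *\<^sub>C z"] cinner_diff_left[of "x - m"]
          cinner_diff_right[of _ "x - m"] cinner_scaleC_left cinner_scaleC_right cinner_self[of "x - m"] p_def N_def cinner_self[of z]
        using cinner_commute[of z "x - m"] by (simp add: algebra_simps)
      also have "complex_of_real ((norm (x - m))\<^sup>2) - cnj c * p - c * cnj p + c * cnj c * complex_of_real N
          = complex_of_real ((norm (x - m))\<^sup>2) - p * cnj p / complex_of_real N"
        using N by (simp add: c_def field_simps)
      also have "\<dots> = complex_of_real ((norm (x - m))\<^sup>2 - (cmod p)\<^sup>2 / N)"
        by (simp add: complex_norm_square[symmetric])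
      finally have "(cmod p)\<^sup>2 / N \<le> 0" by simp
      then have "p = 0" using N by (simp add: divide_le_0_iff)
      then show ?thesis by (simp add: p_def)
    qed simp
  qed
qed

text \<open>The component \<open>n\<close> of a vector outside the closed kernel of \<open>f\<close>
  is orthogonal to that kernel, and every \<open>z\<close> differs from a multiple of
  \<open>n\<close> by an element of the kernel. The representing vector is therefore a multiple of
  \<open>n\<close>, with a conjugated coefficient because \<open>cinner\<close> is linear in its
  first argument.\<close>

lemma riesz_representation:
  fixes f :: "'a::complex_hilbert \<Rightarrow> complex"
  assumes add: "\<And>x y. f (x + y) = f x + f y" and scale: "\<And>c x. f (c *\<^sub>C x) = c * f x"
    and bound: "\<And>x. cmod (f x) \<le> K * norm x"
  obtains y where "\<And>x. f x = cinner x y"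
proof (cases "\<forall>x. f x = 0")
  case True
  then show thesis by (intro that[of 0]) auto
next
  case False
  then obtain x where x: "f x \<noteq> 0" by blast
  have f: "bounded_clinear f"
    by (rule bounded_clinearI[where K = K]) (auto simp: add scale bound scaleC_complex_def)
  have "csubspace {z. f z = 0}"
    by (rule complex_vector.subspaceI) (auto simp: add scale bounded_clinear_zero[OF f])
  moreover have "closed {z. f z = 0}"
    using bounded_linear.continuous_on[OF bounded_clinear_imp_bounded_linear[OF f] continuous_on_id]
    by (intro closed_Collect_eq) auto
  ultimately obtain m where m: "f m = 0" "\<And>z. f z = 0 \<Longrightarrow> cinner (x - m) z = 0"
    using closed_csubspace_projection[of "{z. f z = 0}" x] by auto
  define n where "n = x - m"
  have fn: "f n = f x" using add[of n m] m(1) by (simp add: n_def)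
  then have n0: "n \<noteq> 0" using x bounded_clinear_zero[OF f] by auto
  show thesis
  proof (rule that)
    fix z
    have "f (z - (f z / f n) *\<^sub>C n) = 0"
      using x fn by (simp add: bounded_clinear_diff[OF f] scale)
    from m(2)[OF this] have "cinner (z - (f z / f n) *\<^sub>C n) n = 0"
      by (metis cinner_commute complex_cnj_zero n_def)
    then have "cinner z n = (f z / f n) * cinner n n" by (simp add: cinner_simps)
    then show "f z = cinner z ((cnj (f n / cinner n n)) *\<^sub>C n)"
      using n0 x fn by (simp add: cinner_simps cinner_self_eq_0)
  qed
qed

text \<open>Riesz representation of the functional sending x to the inner product of A x with y
  yields the value B y. Uniqueness of that vector gives linearity, and the Cauchy-Schwarz estimate
  at x = B y gives the bound.\<close>

lemma cadjoint_exists: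
  fixes A :: "'a::complex_hilbert \<Rightarrow> 'b::complex_hilbert"
  assumes A: "bounded_clinear A"
  shows "\<exists>B. bounded_clinear B \<and> (\<forall>x y. cinner (A x) y = cinner x (B y))"
proof -
  obtain K where K: "K > 0" "\<And>x. norm (A x) \<le> K * norm x"
    using bounded_clinear_bound[OF A] by blast
  have CS: "cmod (cinner (A x) y) \<le> K * norm y * norm x" for x y
    using cinner_Cauchy_Schwarz[of "A x" y] mult_right_mono[OF K(2)[of x], of "norm y"]
    by (simp add: mult_ac)
  have "\<exists>z. \<forall>x. cinner (A x) y = cinner x z" for y
    by (rule riesz_representation[of "\<lambda>x. cinner (A x) y" "K * norm y"])
      (auto simp: bounded_clinear_add[OF A] bounded_clinear_scaleC[OF A] cinner_simps CS)
  then obtain B where B: "\<And>x y. cinner (A x) y = cinner x (B y)" by metis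
  have "norm (B y) \<le> K * norm y" for y
  proof (cases "B y = 0")
    case False
    have "norm (B y) * norm (B y) \<le> K * norm y * norm (B y)"
      using CS[of "B y" y] by (simp add: B cinner_self power2_eq_square norm_mult)
    then show ?thesis using False by simp
  qed (use K(1) in simp)
  moreover have "B (y + z) = B y + B z" for y z
    by (rule cinner_ext_right) (simp add: cinner_simps flip: B)
  moreover have "B (c *\<^sub>C y) = c *\<^sub>C B y" for c y
    by (rule cinner_ext_right) (simp add: cinner_simps flip: B)
  ultimately have "bounded_clinear B" by (intro bounded_clinearI)
  with B show ?thesis by blast
qed

lemma cadjoint_eqI:
  fixes A :: "'a::complex_hilbert \<Rightarrow> 'b::complex_hilbert"
  assumes "bounded_clinear B" "\<And>x y. cinner (A x) y = cinner x (B y)"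
  shows "cadjoint A = B"
  unfolding cadjoint_def
proof (rule the_equality)
  fix C assume "bounded_clinear C \<and> (\<forall>x y. cinner (A x) y = cinner x (C y))"
  then have "cinner x (C y) = cinner x (B y)" for x y using assms(2) by metis
  then show "C = B" using cinner_ext_right by blast
qed (use assms in blast)

lemma
  fixes A :: "'a::complex_hilbert \<Rightarrow> 'b::complex_hilbert"
  assumes "bounded_clinear A"
  shows bounded_clinear_cadjoint: "bounded_clinear (cadjoint A)"
    and cinner_cadjoint_right: "cinner x (cadjoint A y) = cinner (A x) y"
  using cadjoint_exists[OF assms] cadjoint_eqI by metis+

lemma cinner_cadjoint_left:
  fixes A :: "'a::complex_hilbert \<Rightarrow> 'b::complex_hilbert"
  assumes "bounded_clinear A"
  shows "cinner (cadjoint A y) x = cinner y (A x)"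
  by (metis assms cinner_cadjoint_right cinner_commute)

lemma cadjoint_cadjoint:
  fixes A :: "'a::complex_hilbert \<Rightarrow> 'b::complex_hilbert"
  assumes "bounded_clinear A"
  shows "cadjoint (cadjoint A) = A"
  by (rule cadjoint_eqI[OF assms]) (rule cinner_cadjoint_left[OF assms])

lemma cadjoint_compose:
  fixes A :: "'b::complex_hilbert \<Rightarrow> 'c::complex_hilbert" and B :: "'a::complex_hilbert \<Rightarrow> 'b"
  assumes "bounded_clinear A" "bounded_clinear B"
  shows "cadjoint (A \<circ> B) = cadjoint B \<circ> cadjoint A"
  by (rule cadjoint_eqI)
    (auto intro: bounded_clinear_compose bounded_clinear_cadjoint assms simp: cinner_cadjoint_right assms)

lemma cadjoint_id: "cadjoint (id :: 'a::complex_hilbert \<Rightarrow> 'a) = id"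
  by (rule cadjoint_eqI) (auto intro: bounded_clinear_id)

section \<open>Square roots of positive operators\<close>

lemma positive_opD: "positive_op D \<Longrightarrow> bounded_clinear D"
  by (simp add: positive_op_def)

text \<open>The quadratic form of \<open>D\<close> is real, so the difference of the two sides is a
  sesquilinear form that vanishes on the diagonal.\<close>

lemma positive_op_selfadjoint:
  fixes D :: "'a::complex_hilbert \<Rightarrow> 'a"
  assumes "positive_op D"
  shows "cinner (D x) y = cinner x (D y)"
proof -
  note D = positive_opD[OF assms]
  have "cinner (D z) z - cinner z (D z) = 0" for z
  proof -
    have "cinner (D z) z \<in> \<real>\<^sub>\<ge>\<^sub>0" using assms by (simp add: positive_op_def)
    then have "cnj (cinner (D z) z) = cinner (D z) z"
      by (simp add: complex_nonneg_Reals_iff complex_eq_iff)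
    then show ?thesis by (metis cinner_commute right_minus_eq)
  qed
  from sesquilinear_eq_0[of "\<lambda>x y. cinner (D x) y - cinner x (D y)", OF _ _ _ _ this]
  have "cinner (D x) y - cinner x (D y) = 0"
    by (simp add: cinner_simps bounded_clinear_add[OF D] bounded_clinear_scaleC[OF D] algebra_simps)
  then show ?thesis by simp
qed

lemma positive_opI:
  fixes D :: "'a::complex_hilbert \<Rightarrow> 'a"
  assumes "bounded_clinear D" "\<And>x y. cinner (D x) y = cinner x (D y)"
    and "\<And>x. Re (cinner (D x) x) \<ge> 0"
  shows "positive_op D"
proof -
  have "Im (cinner (D x) x) = 0" for x
    using arg_cong[OF cinner_commute[of "D x" x], of Im] by (simp add: assms(2))
  with assms show ?thesis by (simp add: positive_op_def complex_nonneg_Reals_iff)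
qed

lemma positive_op_Re_nonneg:
  fixes D :: "'a::complex_hilbert \<Rightarrow> 'a"
  assumes "positive_op D"
  shows "Re (cinner (D x) x) \<ge> 0"
  using assms by (simp add: positive_op_def complex_nonneg_Reals_iff)

text \<open>This is positivity of \<open>D\<close> at the vector \<open>x - D x / K\<close>.\<close>

lemma positive_op_norm_le:
  fixes D :: "'a::complex_hilbert \<Rightarrow> 'a"
  assumes pos: "positive_op D" and K: "K > 0" "\<And>x. norm (D x) \<le> K * norm x"
  shows "(norm (D x))\<^sup>2 \<le> K * Re (cinner (D x) x)"
proof -
  note D = positive_opD[OF pos]
  define t where "t = 1 / K"
  have DD: "Re (cinner (D (D x)) (D x)) \<le> K * (norm (D x))\<^sup>2"
  proof -
    have "Re (cinner (D (D x)) (D x)) \<le> norm (D (D x)) * norm (D x)"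
      using complex_Re_le_cmod cinner_Cauchy_Schwarz order_trans by blast
    also have "\<dots> \<le> K * norm (D x) * norm (D x)" by (intro mult_right_mono K) simp
    finally show ?thesis by (simp add: power2_eq_square mult.assoc)
  qed
  have "0 \<le> Re (cinner (D (x - t *\<^sub>R D x)) (x - t *\<^sub>R D x))"
    by (rule positive_op_Re_nonneg[OF pos])
  also have "\<dots> = Re (cinner (D x) x) - 2 * t * (norm (D x))\<^sup>2 + t\<^sup>2 * Re (cinner (D (D x)) (D x))"
    unfolding norm_sq_eq_Re_cinner using positive_op_selfadjoint[OF pos, of "D x" x]
    by (simp add: bounded_clinear_diff[OF D] bounded_clinear_scaleR[OF D] cinner_simps power2_eq_square algebra_simps)
  also have "\<dots> \<le> Re (cinner (D x) x) - 2 * t * (norm (D x))\<^sup>2 + t\<^sup>2 * (K * (norm (D x))\<^sup>2)"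
    by (intro add_left_mono mult_left_mono DD) simp
  also have "\<dots> = Re (cinner (D x) x) - (norm (D x))\<^sup>2 / K"
    using K(1) by (simp add: t_def power2_eq_square)
  finally show ?thesis using K(1) by (simp add: field_simps)
qed

lemma positive_op_eq_0:
  fixes D :: "'a::complex_hilbert \<Rightarrow> 'a"
  assumes pos: "positive_op D" and "Re (cinner (D x) x) = 0"
  shows "D x = 0"
proof -
  obtain K where "K > 0" "\<And>x. norm (D x) \<le> K * norm x"
    using bounded_clinear_bound[OF positive_opD[OF pos]] by blast
  from positive_op_norm_le[OF pos this, of x] assms(2) show ?thesis by simp
qed

text \<open>Visser's iteration for \<open>1 - sqrt (1 - A)\<close>. The scalar iteration at \<open>A = 1\<close> increases to \<open>1\<close>
  and dominates the increments of the operator iteration.\<close>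

primrec visser :: "('a::real_vector \<Rightarrow> 'a) \<Rightarrow> nat \<Rightarrow> 'a \<Rightarrow> 'a" where
  "visser A 0 x = 0"
| "visser A (Suc n) x = (1 / 2) *\<^sub>R (A x + visser A n (visser A n x))"

primrec visser_bound :: "nat \<Rightarrow> real" where
  "visser_bound 0 = 0"
| "visser_bound (Suc n) = (1 + (visser_bound n)\<^sup>2) / 2"

lemma visser_bound_range: "0 \<le> visser_bound n" "visser_bound n \<le> 1"
proof (induction n)
  case (Suc n)
  case 2
  have "(visser_bound n)\<^sup>2 \<le> 1" using Suc by (simp add: power_le_one)
  then show ?case by simp
qed simp_all

text \<open>For y = \<open>visser_bound n\<close> the increment is half the square of 1 - y.\<close>

lemma incseq_visser_bound: "incseq visser_bound"
proof (rule incseq_SucI)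
  fix n
  have "0 \<le> (1 - visser_bound n)\<^sup>2" by simp
  then show "visser_bound n \<le> visser_bound (Suc n)"
    by (simp add: power2_eq_square algebra_simps)
qed

text \<open>\<open>Y\<close> is the pointwise limit of the iteration. The fixed-point equation says
  that 1 - Y is a square root of 1 - A. The last clause, inherited from the iterates, provides the
  commutation on which uniqueness of the square root rests.\<close>

lemma contraction_sqrt_exists:
  fixes A :: "'a::complex_hilbert \<Rightarrow> 'a"
  assumes A: "bounded_clinear A" and contr: "\<And>x. norm (A x) \<le> norm x"
    and sa: "\<And>x y. cinner (A x) y = cinner x (A y)"
  obtains Y where "bounded_clinear Y" "\<And>x. norm (Y x) \<le> norm x"
    "\<And>x y. cinner (Y x) y = cinner x (Y y)" "\<And>x. A x + Y (Y x) = 2 *\<^sub>R Y x"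
    "\<And>S x. bounded_clinear S \<Longrightarrow> (\<And>x. S (A x) = A (S x)) \<Longrightarrow> S (Y x) = Y (S x)"
proof -
  let ?v = "visser A" and ?y = visser_bound
  have v_add: "?v n (x + z) = ?v n x + ?v n z" for n x z
    by (induction n arbitrary: x z)
      (simp_all add: bounded_clinear_add[OF A] scaleR_add_right)
  have v_scale: "?v n (c *\<^sub>C x) = c *\<^sub>C ?v n x" for n c x
  proof (induction n arbitrary: x)
    case (Suc n)
    have "(1/2) *\<^sub>R c *\<^sub>C z = c *\<^sub>C (1/2) *\<^sub>R z" for z :: 'a
      unfolding scaleC_of_real[symmetric] scaleC_scaleC by (simp add: mult.commute)
    then show ?case by (simp add: Suc bounded_clinear_scaleC[OF A] flip: scaleC_add_right)
  qed simp
  have v_diff: "?v n (x - z) = ?v n x - ?v n z" for n x z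
    using v_add[of n "x - z" z] by (simp add: algebra_simps)
  have v_sa: "cinner (?v n x) z = cinner x (?v n z)" for n x z
    by (induction n arbitrary: x z) (simp_all add: cinner_simps sa)
  have v_commute: "S (?v n x) = ?v n (S x)"
    if "bounded_clinear S" "\<And>x. S (A x) = A (S x)" for S n x
    by (induction n arbitrary: x)
      (simp_all add: that bounded_clinear_zero bounded_clinear_scaleR bounded_clinear_add)
  have v_norm: "norm (?v n x) \<le> ?y n * norm x" for n x
  proof (induction n arbitrary: x)
    case (Suc n)
    have "norm (?v n (?v n x)) \<le> ?y n * (?y n * norm x)"
      using Suc[of "?v n x"] mult_left_mono[OF Suc[of x] visser_bound_range(1)[of n]] by linarith
    then have "norm (A x + ?v n (?v n x)) \<le> norm x + ?y n * (?y n * norm x)"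
      using norm_triangle_ineq[of "A x" "?v n (?v n x)"] contr[of x] by linarith
    then show ?case by (simp add: power2_eq_square distrib_left mult_ac)
  qed simp
  have v_norm1: "norm (?v n x) \<le> norm x" for n x
    using v_norm[of n x] mult_right_mono[OF visser_bound_range(2)[of n], of "norm x"] by simp
  have v_step: "norm (?v (Suc n) x - ?v n x) \<le> (?y (Suc n) - ?y n) * norm x" for n x
  proof (induction n arbitrary: x)
    case 0
    show ?case using contr[of x] by simp
  next
    case (Suc n)
    let ?w = "?v (Suc n)" and ?u = "?v n" and ?d = "?y (Suc n) - ?y n"
    have d: "?d \<ge> 0" using incseq_SucD[OF incseq_visser_bound] by (simp del: visser_bound.simps)
    \<comment> \<open>This splits w w - u u as w (w - u) + (w - u) u. The scalar identity of the
      same shape turns the resulting bound into the difference of the squares of consecutive values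
      of \<open>visser_bound\<close>.\<close>
    have "?w (?w x) - ?u (?u x) = ?w (?w x - ?u x) + (?w (?u x) - ?u (?u x))"
      by (simp only: v_diff) simp
    also have "norm \<dots> \<le> ?y (Suc n) * norm (?w x - ?u x) + ?d * norm (?u x)"
      by (rule order_trans[OF norm_triangle_ineq add_mono[OF v_norm Suc]])
    also have "\<dots> \<le> ?y (Suc n) * (?d * norm x) + ?d * (?y n * norm x)"
      by (intro add_mono mult_left_mono Suc v_norm visser_bound_range d)
    also have "\<dots> = ((?y (Suc n))\<^sup>2 - (?y n)\<^sup>2) * norm x"
      by (simp only: power2_eq_square) (simp only: algebra_simps)
    finally have le: "norm (?w (?w x) - ?u (?u x)) \<le> ((?y (Suc n))\<^sup>2 - (?y n)\<^sup>2) * norm x" .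
    have "?v (Suc (Suc n)) x - ?v (Suc n) x = (1 / 2) *\<^sub>R (?w (?w x) - ?u (?u x))"
      unfolding visser.simps(2)[of A "Suc n"] visser.simps(2)[of A n x] by (simp add: algebra_simps)
    then have "norm (?v (Suc (Suc n)) x - ?v (Suc n) x) = norm (?w (?w x) - ?u (?u x)) / 2"
      by simp
    also have "\<dots> \<le> ((?y (Suc n))\<^sup>2 - (?y n)\<^sup>2) / 2 * norm x" using le by simp
    also have "((?y (Suc n))\<^sup>2 - (?y n)\<^sup>2) / 2 = ?y (Suc (Suc n)) - ?y (Suc n)"
      by (simp add: add_divide_distrib diff_divide_distrib)
    finally show ?case .
  qed
  have v_Cauchy: "norm (?v m x - ?v n x) \<le> (?y m - ?y n) * norm x" if "n \<le> m" for m n x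
    using that
  proof (induction m rule: dec_induct)
    case (step m)
    have "norm (?v (Suc m) x - ?v n x) \<le> norm (?v (Suc m) x - ?v m x) + norm (?v m x - ?v n x)"
      using norm_triangle_ineq[of "?v (Suc m) x - ?v m x" "?v m x - ?v n x"] by simp
    also have "\<dots> \<le> (?y (Suc m) - ?y m) * norm x + (?y m - ?y n) * norm x"
      by (intro add_mono v_step step)
    finally show ?case by (simp add: algebra_simps del: visser_bound.simps visser.simps)
  qed simp
  have "convergent ?y"
    using incseq_convergent[OF incseq_visser_bound, of 1] visser_bound_range(2)
    unfolding convergent_def by metis
  then have y_Cauchy: "Cauchy ?y" by (simp add: Cauchy_convergent_iff)
  have "convergent (\<lambda>n. ?v n x)" for x
    unfolding Cauchy_convergent_iff[symmetric]
  proof (rule CauchyI')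
    fix e :: real assume e: "e > 0"
    \<comment> \<open>Adding 1 keeps the denominator positive when \<open>x = 0\<close>.\<close>
    then have e': "e / (norm x + 1) > 0" by (simp add: add_nonneg_pos)
    obtain M where M: "\<And>m n. m \<ge> M \<Longrightarrow> n \<ge> M \<Longrightarrow> norm (?y m - ?y n) < e / (norm x + 1)"
      using CauchyD[OF y_Cauchy e'] by blast
    have "norm (?v m x - ?v n x) < e" if "m \<ge> M" "m < n" for m n
    proof -
      have "norm (?v m x - ?v n x) \<le> (?y n - ?y m) * norm x"
        using v_Cauchy[of m n x] that by (simp add: norm_minus_commute)
      also have "\<dots> \<le> norm (?y n - ?y m) * (norm x + 1)" by (intro mult_mono) auto
      also have "\<dots> < e"
        using M[of n m] that by (simp add: pos_less_divide_eq add_nonneg_pos)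
      finally show ?thesis .
    qed
    then show "\<exists>M. \<forall>m\<ge>M. \<forall>n>m. dist (?v m x) (?v n x) < e" unfolding dist_norm by blast
  qed
  then obtain Y where Y: "\<And>x. (\<lambda>n. ?v n x) \<longlonglongrightarrow> Y x" unfolding convergent_def by metis
  have Y_norm: "norm (Y x) \<le> norm x" for x
    by (rule LIMSEQ_le_const2[OF tendsto_norm[OF Y]]) (use v_norm1 in blast)
  have cY: "bounded_clinear Y"
  proof (rule bounded_clinearI[where K = 1])
    show "Y (x + z) = Y x + Y z" for x z
      using LIMSEQ_unique[OF Y[of "x + z"]] tendsto_add[OF Y[of x] Y[of z]] by (simp add: v_add)
    show "Y (c *\<^sub>C x) = c *\<^sub>C Y x" for c x
      using LIMSEQ_unique[OF Y[of "c *\<^sub>C x"]]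
        bounded_clinear_tendsto[OF bounded_clinear_scaleC_right[of c] Y[of x]]
      by (simp add: v_scale)
  qed (use Y_norm in simp)
  show thesis
  proof
    show "bounded_clinear Y" by (rule cY)
    show "norm (Y x) \<le> norm x" for x by (rule Y_norm)
    show "cinner (Y x) z = cinner x (Y z)" for x z
      using LIMSEQ_unique[OF tendsto_cinner[OF Y[of x] tendsto_const[of z]]]
        tendsto_cinner[OF tendsto_const[of x] Y[of z]] by (simp add: v_sa)
    show "A x + Y (Y x) = 2 *\<^sub>R Y x" for x
    proof -
      \<comment> \<open>Both the operator and its argument vary with \<open>n\<close>. Since all
        iterates are contractions, replacing the inner \<open>?v n x\<close> by its limit costs an
        error tending to zero, and the recursion passes to the limit.\<close>
      have "(\<lambda>n. ?v n (?v n x - Y x)) \<longlonglongrightarrow> 0"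
      proof (rule Lim_null_comparison)
        show "(\<lambda>n. norm (?v n x - Y x)) \<longlonglongrightarrow> 0"
          using LIM_zero[OF Y[of x]] by (rule tendsto_norm_zero)
      qed (use v_norm1 in simp)
      from tendsto_add[OF this Y[of "Y x"]] have "(\<lambda>n. ?v n (?v n x)) \<longlonglongrightarrow> Y (Y x)"
        by (simp add: v_diff)
      then have "(\<lambda>n. 2 *\<^sub>R ?v (Suc n) x) \<longlonglongrightarrow> A x + Y (Y x)"
        by (simp add: tendsto_add)
      moreover have "(\<lambda>n. 2 *\<^sub>R ?v (Suc n) x) \<longlonglongrightarrow> 2 *\<^sub>R Y x"
        by (intro tendsto_scaleR tendsto_const LIMSEQ_Suc Y)
      ultimately show ?thesis by (rule LIMSEQ_unique)
    qed
    show "S (Y x) = Y (S x)" if S: "bounded_clinear S" "\<And>x. S (A x) = A (S x)" for S x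
      using LIMSEQ_unique[OF bounded_clinear_tendsto[OF S(1) Y[of x]]] Y[of "S x"]
      by (simp add: v_commute[OF S])
  qed
qed

text \<open>For a bound K of D, the operator A = 1 - D / K is a self-adjoint contraction by
  \<open>positive_op_norm_le\<close>. With the associated Y, set R = sqrt K (1 - Y): its square is K
  (1 - A) = D, and R is positive because Y is a contraction.\<close>

lemma positive_op_sqrt_exists:
  fixes D :: "'a::complex_hilbert \<Rightarrow> 'a"
  assumes pos: "positive_op D"
  obtains R where "positive_op R" "\<And>x. R (R x) = D x"
    "\<And>S x. bounded_clinear S \<Longrightarrow> (\<And>x. S (D x) = D (S x)) \<Longrightarrow> S (R x) = R (S x)"
proof -
  note D = positive_opD[OF pos]
  obtain K where K: "K > 0" "\<And>x. norm (D x) \<le> K * norm x"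
    using bounded_clinear_bound[OF D] by blast
  define A where "A x = x - (1 / K) *\<^sub>R D x" for x
  have contr: "norm (A x) \<le> norm x" for x
  proof (rule power2_le_imp_le)
    have "(norm (A x))\<^sup>2 = (norm x)\<^sup>2 - 2 / K * Re (cinner (D x) x) + (norm (D x))\<^sup>2 / K\<^sup>2"
      unfolding norm_sq_eq_Re_cinner A_def using Re_cinner_commute[of x "D x"]
      by (simp add: cinner_simps power2_eq_square diff_divide_distrib)
    also have "(norm (D x))\<^sup>2 / K\<^sup>2 \<le> K * Re (cinner (D x) x) / K\<^sup>2"
      by (intro divide_right_mono positive_op_norm_le pos K) simp
    also have "(norm x)\<^sup>2 - 2 / K * Re (cinner (D x) x) + K * Re (cinner (D x) x) / K\<^sup>2
        = (norm x)\<^sup>2 - Re (cinner (D x) x) / K"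
      using K(1) by (simp add: power2_eq_square field_simps)
    also have "\<dots> \<le> (norm x)\<^sup>2" using positive_op_Re_nonneg[OF pos, of x] K(1) by simp
    finally show "(norm (A x))\<^sup>2 \<le> (norm x)\<^sup>2" by simp
  qed simp
  have A: "bounded_clinear A"
  proof (rule bounded_clinearI[where K = 1])
    show "A (c *\<^sub>C x) = c *\<^sub>C A x" for c x
      unfolding A_def bounded_clinear_scaleC[OF D] scaleC_of_real[symmetric]
        complex_vector.scale_right_diff_distrib scaleC_scaleC by (simp add: mult.commute)
  qed (use contr in \<open>auto simp: A_def bounded_clinear_add[OF D] algebra_simps\<close>)
  have A_sa: "cinner (A x) y = cinner x (A y)" for x y
    by (simp add: A_def cinner_simps positive_op_selfadjoint[OF pos])
  from contraction_sqrt_exists[OF A contr A_sa]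
  obtain Y where Y: "bounded_clinear Y" "\<And>x. norm (Y x) \<le> norm x"
    "\<And>x y. cinner (Y x) y = cinner x (Y y)" "\<And>x. A x + Y (Y x) = 2 *\<^sub>R Y x"
    "\<And>S x. bounded_clinear S \<Longrightarrow> (\<And>x. S (A x) = A (S x)) \<Longrightarrow> S (Y x) = Y (S x)"
    by blast
  define R where "R x = sqrt K *\<^sub>R (x - Y x)" for x
  have "bounded_clinear R"
  proof (rule bounded_clinearI[where K = "sqrt K * 2"])
    show "R (c *\<^sub>C x) = c *\<^sub>C R x" for c x
      unfolding R_def bounded_clinear_scaleC[OF Y(1)] scaleC_of_real[symmetric]
        complex_vector.scale_right_diff_distrib[symmetric] scaleC_scaleC by (simp add: mult.commute)
    show "norm (R x) \<le> sqrt K * 2 * norm x" for x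
    proof -
      have "norm (x - Y x) \<le> 2 * norm x" using norm_triangle_ineq4[of x "Y x"] Y(2)[of x] by linarith
      then show ?thesis using K(1) by (simp add: R_def)
    qed
  qed (simp add: R_def bounded_clinear_add[OF Y(1)] algebra_simps)
  then have "positive_op R"
  proof (rule positive_opI)
    show "cinner (R x) y = cinner x (R y)" for x y by (simp add: R_def cinner_simps Y(3))
    show "Re (cinner (R x) x) \<ge> 0" for x
    proof -
      have "Re (cinner (Y x) x) \<le> norm (Y x) * norm x"
        using complex_Re_le_cmod cinner_Cauchy_Schwarz order_trans by blast
      also have "\<dots> \<le> norm x * norm x" by (intro mult_right_mono Y) simp
      also have "\<dots> = Re (cinner x x)"
        unfolding norm_sq_eq_Re_cinner[symmetric] power2_eq_square ..
      finally show ?thesis using K(1) by (simp add: R_def cinner_simps)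
    qed
  qed
  moreover have "R (R x) = D x" for x
  proof -
    have "R (R x) = (sqrt K * sqrt K) *\<^sub>R (x - Y x - (Y x - Y (Y x)))"
      unfolding R_def bounded_clinear_scaleR[OF Y(1)] bounded_clinear_diff[OF Y(1)]
      by (simp add: algebra_simps)
    also have "x - Y x - (Y x - Y (Y x)) = x - A x"
      using Y(4)[of x] by (simp add: algebra_simps scaleR_2)
    also have "(sqrt K * sqrt K) *\<^sub>R (x - A x) = D x"
      using K(1) by (simp add: A_def)
    finally show ?thesis .
  qed
  moreover have "S (R x) = R (S x)"
    if S: "bounded_clinear S" "\<And>x. S (D x) = D (S x)" for S x
  proof -
    have "S (A x) = A (S x)" for x
      by (simp add: A_def bounded_clinear_diff bounded_clinear_scaleR S)
    from Y(5)[OF S(1) this] show ?thesis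
      by (simp add: R_def bounded_clinear_diff bounded_clinear_scaleR S)
  qed
  ultimately show thesis by (rule that)
qed

text \<open>Since R and S commute, (R + S)(R - S) = 0. For y = (R - S) x the two nonnegative
  quadratic forms at y thus add up to zero, so R y = S y = 0, and the squared norm of y is the inner
  product of x with (R - S) y.\<close>

lemma sqrt_op_unique:
  fixes D :: "'a::complex_hilbert \<Rightarrow> 'a"
  assumes R: "positive_op R" "\<And>x. R (R x) = D x"
    and S: "positive_op S" "\<And>x. S (S x) = D x"
    and commute: "\<And>x. S (R x) = R (S x)"
  shows "S = R"
proof
  fix x
  note cR = positive_opD[OF R(1)] and cS = positive_opD[OF S(1)]
  define y where "y = R x - S x"
  have "R y + S y = 0"
    by (simp add: y_def bounded_clinear_diff[OF cR] bounded_clinear_diff[OF cS] R S commute)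
  then have "Re (cinner (R y) y) + Re (cinner (S y) y) = 0"
    by (metis cinner_add_left cinner_zero_left plus_complex.sel(1) zero_complex.sel(1))
  then have "Re (cinner (R y) y) = 0" "Re (cinner (S y) y) = 0"
    using positive_op_Re_nonneg[OF R(1), of y] positive_op_Re_nonneg[OF S(1), of y] by linarith+
  then have "R y = 0" "S y = 0" using positive_op_eq_0 R(1) S(1) by blast+
  moreover have "cinner y y = cinner x (R y - S y)"
    by (subst y_def)
      (simp add: cinner_simps positive_op_selfadjoint[OF R(1)] positive_op_selfadjoint[OF S(1)])
  ultimately have "y = 0" by (simp add: cinner_self_eq_0)
  then show "S x = R x" by (simp add: y_def)
qed

text \<open>Any positive root S commutes with its square D, hence with the constructed root R, and
  so equals it. This justifies the definite description in \<open>sqrt_op\<close>.\<close>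

lemma
  fixes D :: "'a::complex_hilbert \<Rightarrow> 'a"
  assumes pos: "positive_op D"
  shows positive_sqrt_op: "positive_op (sqrt_op D)"
    and sqrt_op_sqrt_op: "sqrt_op D (sqrt_op D x) = D x"
proof -
  obtain R where R: "positive_op R" "\<And>x. R (R x) = D x"
    "\<And>S x. bounded_clinear S \<Longrightarrow> (\<And>x. S (D x) = D (S x)) \<Longrightarrow> S (R x) = R (S x)"
    using positive_op_sqrt_exists[OF pos] by blast
  have "sqrt_op D = R"
    unfolding sqrt_op_def
  proof (rule the_equality)
    fix S assume S: "positive_op S \<and> S \<circ> S = D"
    then have SS: "S (S x) = D x" for x by (metis comp_apply)
    then have "S (D x) = D (S x)" for x by metis
    with S SS R show "S = R" using sqrt_op_unique positive_opD by metis
  qed (use R in auto)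
  with R show "positive_op (sqrt_op D)" "sqrt_op D (sqrt_op D x) = D x" by auto
qed

text \<open>Presents D in the factored form of condition (ii), so that results on factored series
  apply to condition (iii).\<close>

lemma cadjoint_sqrt_op_comp_sqrt_op:
  fixes D :: "'a::complex_hilbert \<Rightarrow> 'a"
  assumes "positive_op D"
  shows "cadjoint (sqrt_op D) \<circ> sqrt_op D = D"
proof -
  note R = positive_sqrt_op[OF assms]
  have "cadjoint (sqrt_op D) = sqrt_op D"
    by (rule cadjoint_eqI[OF positive_opD[OF R] positive_op_selfadjoint[OF R]])
  then show ?thesis by (simp add: fun_eq_iff sqrt_op_sqrt_op[OF assms])
qed

section \<open>Operators into square-summable families\<close>

lemma ell2_eqI: "(\<And>i. ell2_nth f i = ell2_nth g i) \<Longrightarrow> f = g"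
  by (metis ell2_nth_inject ext)

lemma bounded_clinear_ell2_nth:
  "bounded_clinear (\<lambda>u :: ('i, 'e::complex_hilbert) ell2. ell2_nth u i)"
  by (rule bounded_clinearI[where K = 1])
    (auto simp: plus_ell2.rep_eq scaleC_ell2.rep_eq norm_ell2_nth_le)

lemma has_sum_cinner_ell2: "((\<lambda>i. cinner (ell2_nth u i) (ell2_nth v i)) has_sum cinner u v) UNIV"
  unfolding cinner_ell2_def
  by (intro has_sum_infsum square_summable_cinner square_summable_ell2_nth)

text \<open>The uniform bound on finite sums of squares makes each family square-summable and bounds
  the assembled operator by \<open>sqrt K\<close>. Both the weighted shifts and the operator V of
  condition (i) are built in this way.\<close>

lemma ell2_operator_exists:
  fixes f :: "'i \<Rightarrow> 'a::complex_hilbert \<Rightarrow> 'e::complex_hilbert"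
  assumes f: "\<And>i. bounded_clinear (f i)"
    and bound: "\<And>F x. finite F \<Longrightarrow> (\<Sum>i\<in>F. (norm (f i x))\<^sup>2) \<le> K * (norm x)\<^sup>2"
  obtains V :: "'a \<Rightarrow> ('i, 'e) ell2" where "bounded_clinear V" "\<And>x i. ell2_nth (V x) i = f i x"
proof -
  have "(\<lambda>i. (norm (f i x))\<^sup>2) summable_on UNIV" for x
    using bound[of _ x] by (intro nonneg_bdd_above_summable_on bdd_aboveI2[where M = "K * (norm x)\<^sup>2"]) auto
  then have "\<exists>u. ell2_nth u = (\<lambda>i. f i x)" for x
    by (intro exI[of _ "Abs_ell2 (\<lambda>i. f i x)"]) (simp add: Abs_ell2_inverse)
  then obtain V :: "'a \<Rightarrow> ('i, 'e) ell2" where V: "\<And>x. ell2_nth (V x) = (\<lambda>i. f i x)" by metis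
  have "norm (V x) \<le> sqrt K * norm x" for x
  proof (rule norm_ell2_leI)
    fix F :: "'i set" assume "finite F"
    from bound[OF this, of x] have "L2_set (\<lambda>i. norm (f i x)) F \<le> sqrt (K * (norm x)\<^sup>2)"
      unfolding L2_set_def by (rule real_sqrt_le_mono)
    then show "L2_set (\<lambda>i. norm (ell2_nth (V x) i)) F \<le> sqrt K * norm x"
      by (simp add: V real_sqrt_mult)
  qed
  then have "bounded_clinear V"
    by (intro bounded_clinearI[where K = "sqrt K"] ell2_eqI)
      (auto simp: V plus_ell2.rep_eq scaleC_ell2.rep_eq bounded_clinear_add[OF f] bounded_clinear_scaleC[OF f])
  then show thesis by (rule that) (simp add: V)
qed

section \<open>Operators determined by their values on basis vectors\<close>

lemma cinner_fock_basis: "cinner u (\<e> \<alpha>) = ell2_nth u \<alpha>"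
proof -
  have "cinner u (\<e> \<alpha>) = (\<Sum>\<^sub>\<infinity>\<beta>. if \<beta> = \<alpha> then ell2_nth u \<alpha> else 0)"
    unfolding cinner_ell2_def by (intro infsum_cong) (auto simp: fock_basis.rep_eq cinner_complex_def)
  also have "\<dots> = (\<Sum>\<^sub>\<infinity>\<beta>\<in>{\<alpha>}. ell2_nth u \<alpha>)" by (rule infsum_cong_neutral) auto
  finally show ?thesis by simp
qed

text \<open>Bounded operators pass through the expansion of \<open>u\<close> in the tensors
  \<open>\<e> \<alpha> \<otimes> ell2_nth u \<alpha>\<close>. This is the uniqueness half of the
  definite description in \<open>tensor_id\<close>.\<close>

lemma bounded_clinear_eqI_tensor:
  fixes A B :: "('n list, 'e::complex_hilbert) ell2 \<Rightarrow> 'b::complex_hilbert"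
  assumes "bounded_clinear A" "bounded_clinear B" and eq: "\<And>\<alpha> x. A (\<e> \<alpha> \<otimes> x) = B (\<e> \<alpha> \<otimes> x)"
  shows "A = B"
proof
  fix u
  have "((\<lambda>\<alpha>. A (\<e> \<alpha> \<otimes> ell2_nth u \<alpha>)) has_sum A u) UNIV"
    and "((\<lambda>\<alpha>. B (\<e> \<alpha> \<otimes> ell2_nth u \<alpha>)) has_sum B u) UNIV"
    using has_sum_bounded_linear[OF bounded_clinear_imp_bounded_linear has_sum_fock_basis_tensor]
      assms(1,2) by blast+
  then show "A u = B u" unfolding eq by (rule has_sum_unique)
qed

text \<open>The Fock space is the case of complex coefficients in the preceding lemma, where
  tensoring with a number is scaling by it.\<close>

lemma bounded_clinear_eqI_fock:
  fixes A B :: "'n fock \<Rightarrow> 'b::complex_hilbert"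
  assumes A: "bounded_clinear A" and B: "bounded_clinear B" and eq: "\<And>\<alpha>. A (\<e> \<alpha>) = B (\<e> \<alpha>)"
  shows "A = B"
proof (rule bounded_clinear_eqI_tensor[OF A B])
  fix \<alpha> :: "'n list" and c :: complex
  have "\<e> \<alpha> \<otimes> c = c *\<^sub>C \<e> \<alpha>"
    by (rule ell2_eqI) (simp add: tensor.rep_eq scaleC_ell2.rep_eq scaleC_complex_def)
  then show "A (\<e> \<alpha> \<otimes> c) = B (\<e> \<alpha> \<otimes> c)"
    by (simp add: bounded_clinear_scaleC[OF A] bounded_clinear_scaleC[OF B] eq)
qed

section \<open>The tensor product with a closed subspace, and the range of the square root\<close>

lemma fock_tensorI:
  assumes "\<And>\<alpha>. ell2_nth u \<alpha> \<in> E"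
  shows "u \<in> fock_tensor E"
  unfolding fock_tensor_def
proof (rule Lim_in_closed_set[OF closed_closure])
  show "((\<lambda>F. \<Sum>\<alpha>\<in>F. \<e> \<alpha> \<otimes> ell2_nth u \<alpha>) \<longlongrightarrow> u) (finite_subsets_at_top UNIV)"
    using has_sum_fock_basis_tensor[of u] by (simp add: has_sum_def)
  show "\<forall>\<^sub>F F in finite_subsets_at_top UNIV.
      (\<Sum>\<alpha>\<in>F. \<e> \<alpha> \<otimes> ell2_nth u \<alpha>) \<in> closure (cspan {f \<otimes> x | f x. x \<in> E})"
    by (intro always_eventually allI subsetD[OF closure_subset] complex_vector.span_sum
        complex_vector.span_base) (use assms in auto)
qed simp

text \<open>For a fixed word, the families whose coordinate there lies in \<open>E\<close> form a
  closed subspace containing all the generating tensors.\<close>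

lemma fock_tensorD:
  fixes E :: "'e::complex_hilbert set" and u :: "('n list, 'e) ell2"
  assumes E: "hilbert_subspace E" and u: "u \<in> fock_tensor E"
  shows "ell2_nth u \<alpha> \<in> E"
proof -
  have cs: "csubspace E" and cl: "closed E" using E by (auto simp: hilbert_subspace_def)
  let ?M = "{v. ell2_nth v \<alpha> \<in> E}"
  have "cspan {f \<otimes> x | f x. x \<in> E} \<subseteq> ?M"
  proof (rule complex_vector.span_minimal)
    show "csubspace ?M"
      by (rule complex_vector.subspaceI)
        (auto simp: zero_ell2.rep_eq plus_ell2.rep_eq scaleC_ell2.rep_eq complex_vector.subspace_0[OF cs]
          complex_vector.subspace_add[OF cs] complex_vector.subspace_scale[OF cs])
  qed (auto simp: tensor.rep_eq complex_vector.subspace_scale[OF cs])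
  moreover have "isCont (\<lambda>v. ell2_nth v \<alpha>) v" for v :: "('n list, 'e) ell2"
    using bounded_clinear_ell2_nth
    by (intro linear_continuous_at bounded_clinear_imp_bounded_linear)
  from continuous_closed_vimage[OF cl this] have "closed ?M" by (simp add: vimage_def)
  ultimately have "fock_tensor E \<subseteq> ?M"
    unfolding fock_tensor_def by (rule closure_minimal)
  with u show ?thesis by blast
qed

lemma csubspace_closure:
  fixes M :: "'a::complex_hilbert set"
  assumes M: "csubspace M"
  shows "csubspace (closure M)"
proof (rule complex_vector.subspaceI)
  show "0 \<in> closure M"
    using complex_vector.subspace_0[OF M] by (rule subsetD[OF closure_subset])
next
  fix y z assume "y \<in> closure M" "z \<in> closure M"
  then obtain s t where st: "\<forall>n. s n \<in> M" "s \<longlonglongrightarrow> y" "\<forall>n. t n \<in> M" "t \<longlonglongrightarrow> z"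
    unfolding closure_sequential by auto
  have "(\<lambda>n. s n + t n) \<longlonglongrightarrow> y + z" by (intro tendsto_add st)
  moreover have "\<forall>n. s n + t n \<in> M"
    using st complex_vector.subspace_add[OF M] by simp
  ultimately show "y + z \<in> closure M"
    unfolding closure_sequential by (intro exI conjI)
next
  fix c y assume "y \<in> closure M"
  then obtain s where s: "\<forall>n. s n \<in> M" "s \<longlonglongrightarrow> y"
    unfolding closure_sequential by auto
  have "(\<lambda>n. c *\<^sub>C s n) \<longlonglongrightarrow> c *\<^sub>C y"
    using bounded_clinear_scaleC_right s(2) by (rule bounded_clinear_tendsto)
  moreover have "\<forall>n. c *\<^sub>C s n \<in> M"
    using s complex_vector.subspace_scale[OF M] by simp
  ultimately show "c *\<^sub>C y \<in> closure M"
    unfolding closure_sequential by (intro exI conjI)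
qed

text \<open>Let n be the component of \<open>sqrt_op D x\<close> orthogonal to the closed range of
  D. Orthogonality of n to D n gives \<open>sqrt_op D n = 0\<close>, so n is orthogonal to
  \<open>sqrt_op D x\<close> as well, hence to itself. Thus the model map takes its coefficients in
  the space prescribed by the theorem.\<close>

lemma range_sqrt_op_subset:
  fixes D :: "'a::complex_hilbert \<Rightarrow> 'a"
  assumes pos: "positive_op D"
  shows "sqrt_op D x \<in> closure (range D)"
proof -
  note D = positive_opD[OF pos]
  note R = positive_sqrt_op[OF pos]
  have range: "csubspace (range D)"
  proof (rule complex_vector.subspaceI)
    show "0 \<in> range D" using bounded_clinear_zero[OF D] by (metis rangeI)
  qed (auto simp flip: bounded_clinear_add[OF D] bounded_clinear_scaleC[OF D])
  obtain m where m: "m \<in> closure (range D)"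
    "\<And>z. z \<in> closure (range D) \<Longrightarrow> cinner (sqrt_op D x - m) z = 0"
    using closed_csubspace_projection[OF csubspace_closure[OF range] closed_closure, of "sqrt_op D x"] by blast
  define n where "n = sqrt_op D x - m"
  have "cinner n (D n) = 0"
    using m(2)[of "D n"] closure_subset[of "range D"] by (auto simp: n_def)
  then have "cinner (sqrt_op D n) (sqrt_op D n) = 0"
    by (simp add: positive_op_selfadjoint[OF R] sqrt_op_sqrt_op[OF pos])
  then have "sqrt_op D n = 0" by (simp add: cinner_self_eq_0)
  then have "cinner n (sqrt_op D x) = 0"
    by (simp flip: positive_op_selfadjoint[OF R])
  moreover have "cinner n m = 0" using m by (simp add: n_def)
  ultimately have "cinner n n = 0" by (subst (2) n_def) (simp add: cinner_simps)
  then have "n = 0" by (simp add: cinner_self_eq_0)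
  with m(1) show ?thesis by (simp add: n_def)
qed

section \<open>Weighted shifts and their models\<close>

lemma wot_has_sum_iff:
  "wot_has_sum A S I \<longleftrightarrow> bounded_clinear S \<and>
    (\<forall>x y. ((\<lambda>i. cinner (A i x) y) has_sum cinner (S x) y) I)"
  unfolding wot_has_sum_def has_sum_def cinner_sum_left ..

locale weighted_tuple =
  fixes b :: "'n list \<Rightarrow> real" and T :: "'n \<Rightarrow> 'h::complex_hilbert \<Rightarrow> 'h"
  assumes b_pos: "b \<alpha> > 0" and b_Nil: "b [] = 1"
    and b_bdd: "bdd_above (range (\<lambda>\<alpha>. b \<alpha> / b (i # \<alpha>)))"
    and T: "bounded_clinear (T i)"
begin

text \<open>This is the coordinate form of the adjoint of W_i, tensored with the identity. Keeping
  \<open>'e\<close> general gives the operator on the Fock space and its ampliation from one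
  construction.\<close>

lemma weighted_shift_exists:
  obtains S :: "('n list, 'e::complex_hilbert) ell2 \<Rightarrow> ('n list, 'e) ell2"
  where "bounded_clinear S"
    "\<And>u \<alpha>. ell2_nth (S u) \<alpha> = sqrt (b \<alpha> / b (i # \<alpha>)) *\<^sub>R ell2_nth u (i # \<alpha>)"
proof -
  obtain C where C: "\<And>\<alpha>. b \<alpha> / b (i # \<alpha>) \<le> C"
    using b_bdd[of i] unfolding bdd_above_def by blast
  have ratio: "b \<alpha> / b (i # \<alpha>) \<ge> 0" for \<alpha> using b_pos by (simp add: less_imp_le)
  have C0: "C \<ge> 0" using order_trans[OF ratio C] .
  let ?f = "\<lambda>\<alpha> u. sqrt (b \<alpha> / b (i # \<alpha>)) *\<^sub>R ell2_nth u (i # \<alpha>) :: 'e"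
  show thesis
  proof (rule ell2_operator_exists[of ?f C])
    show "bounded_clinear (?f \<alpha>)" for \<alpha>
    proof (rule bounded_clinearI[where K = "sqrt (b \<alpha> / b (i # \<alpha>))"])
      show "?f \<alpha> (c *\<^sub>C u) = c *\<^sub>C ?f \<alpha> u" for c u
        unfolding scaleC_of_real[symmetric] scaleC_ell2.rep_eq scaleC_scaleC by (simp only: mult.commute)
      show "norm (?f \<alpha> u) \<le> sqrt (b \<alpha> / b (i # \<alpha>)) * norm u" for u
        using ratio[of \<alpha>] by (auto intro!: mult_left_mono norm_ell2_nth_le simp del: real_sqrt_divide)
    qed (simp add: plus_ell2.rep_eq scaleR_add_right)
    show "(\<Sum>\<alpha>\<in>F. (norm (?f \<alpha> u))\<^sup>2) \<le> C * (norm u)\<^sup>2" if F: "finite F" for F u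
    proof -
      have "(\<Sum>\<alpha>\<in>F. (norm (?f \<alpha> u))\<^sup>2) = (\<Sum>\<alpha>\<in>F. b \<alpha> / b (i # \<alpha>) * (norm (ell2_nth u (i # \<alpha>)))\<^sup>2)"
        using ratio by (intro sum.cong refl) (simp add: power_mult_distrib power_divide b_pos less_imp_le)
      also have "\<dots> \<le> (\<Sum>\<alpha>\<in>F. C * (norm (ell2_nth u (i # \<alpha>)))\<^sup>2)"
        by (intro sum_mono mult_right_mono C) simp
      \<comment> \<open>Prefixing \<open>i\<close> is injective on words, so the coordinates
        involved are distinct and their squares form a partial sum of the squared norm of
        \<open>u\<close>.\<close>
      also have "\<dots> = C * (\<Sum>\<beta>\<in>(#) i ` F. (norm (ell2_nth u \<beta>))\<^sup>2)"
        by (simp add: sum.reindex sum_distrib_left)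
      also have "(\<Sum>\<beta>\<in>(#) i ` F. (norm (ell2_nth u \<beta>))\<^sup>2) \<le> (norm u)\<^sup>2"
      proof -
        have "(L2_set (\<lambda>\<beta>. norm (ell2_nth u \<beta>)) ((#) i ` F))\<^sup>2 \<le> (norm u)\<^sup>2"
          using F by (intro power_mono L2_set_le_norm_ell2) auto
        then show ?thesis by (simp add: L2_set_def sum_nonneg)
      qed
      finally show ?thesis using C0 by (simp add: mult_left_mono)
    qed
  qed (rule that)
qed

text \<open>The construction runs backwards: the adjoint of the shift \<open>S\<close> acts on the
  basis as W_i should, so it is W_i by uniqueness. Existence of W_i thereby follows from that of
  \<open>S\<close>.\<close>

lemma cadjoint_weighted_creation:
  assumes S: "bounded_clinear S"
    and nth: "\<And>u \<alpha>. ell2_nth (S u) \<alpha> = sqrt (b \<alpha> / b (i # \<alpha>)) *\<^sub>R ell2_nth u (i # \<alpha>)"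
  shows "cadjoint (weighted_creation b i) = S"
proof -
  have basis: "cadjoint S (\<e> \<alpha>) = sqrt (b \<alpha> / b (i # \<alpha>)) *\<^sub>R \<e> (i # \<alpha>)" for \<alpha>
    by (rule cinner_ext_right)
      (simp add: cinner_cadjoint_right[OF S] cinner_simps cinner_fock_basis nth scaleR_conv_of_real
        del: real_sqrt_divide of_real_divide)
  have "weighted_creation b i = cadjoint S"
    unfolding weighted_creation_def
    by (rule the_equality)
      (auto simp: basis bounded_clinear_cadjoint[OF S] intro!: bounded_clinear_eqI_fock)
  then show ?thesis by (simp add: cadjoint_cadjoint[OF S])
qed

text \<open>The shift with coefficients in \<open>'e\<close> agrees on elementary tensors with the
  scalar shift tensored with the identity, which characterizes \<open>tensor_id\<close>.\<close>

lemma tensor_id_cadjoint_weighted_creation: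
  fixes u :: "('n list, 'e::complex_hilbert) ell2"
  shows "ell2_nth (tensor_id (cadjoint (weighted_creation b i)) u) \<alpha> = sqrt (b \<alpha> / b (i # \<alpha>)) *\<^sub>R ell2_nth u (i # \<alpha>)"
proof -
  obtain S where S: "bounded_clinear S"
    "\<And>u \<alpha>. ell2_nth (S u) \<alpha> = sqrt (b \<alpha> / b (i # \<alpha>)) *\<^sub>R (ell2_nth u (i # \<alpha>) :: complex)"
    using weighted_shift_exists by blast
  obtain S' where S': "bounded_clinear S'"
    "\<And>u \<alpha>. ell2_nth (S' u) \<alpha> = sqrt (b \<alpha> / b (i # \<alpha>)) *\<^sub>R (ell2_nth u (i # \<alpha>) :: 'e)"
    using weighted_shift_exists by blast
  have tensor: "S' (f \<otimes> x) = S f \<otimes> x" for f x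
    by (rule ell2_eqI)
      (simp only: S(2) S'(2) tensor.rep_eq scaleR_conv_of_real scaleC_of_real[symmetric] scaleC_scaleC)
  have "tensor_id (cadjoint (weighted_creation b i)) = S'"
    unfolding tensor_id_def cadjoint_weighted_creation[OF S]
    by (rule the_equality) (auto simp: S' tensor intro!: bounded_clinear_eqI_tensor)
  then show ?thesis by (simp only: S'(2))
qed

section \<open>Coordinates of an intertwining operator\<close>

lemma bounded_clinear_word_op: "bounded_clinear (word_op T \<alpha>)"
proof (induction \<alpha>)
  case Nil
  show ?case unfolding word_op.simps by (rule bounded_clinear_id)
next
  case (Cons i \<alpha>)
  with T show ?case unfolding word_op.simps by (rule bounded_clinear_compose)
qed

lemma cadjoint_word_op_Cons:
  "cadjoint (word_op T (i # \<alpha>)) h = cadjoint (word_op T \<alpha>) (cadjoint (T i) h)"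
  by (simp add: cadjoint_compose T bounded_clinear_word_op)

text \<open>The prospective coordinate of V at the word \<alpha>. Leaving \<Theta> arbitrary covers
  both the empty-word coordinate of a given V and the square root of D.\<close>

definition model_coeff :: "('h \<Rightarrow> 'e::complex_hilbert) \<Rightarrow> 'n list \<Rightarrow> 'h \<Rightarrow> 'e"
  where "model_coeff \<Theta> \<alpha> h = sqrt (b \<alpha>) *\<^sub>R \<Theta> (cadjoint (word_op T \<alpha>) h)"

lemma sqrt_b_Cons: "sqrt (b \<alpha> / b (i # \<alpha>)) * sqrt (b (i # \<alpha>)) = sqrt (b \<alpha>)"
  using b_pos[of "i # \<alpha>"] by (simp add: real_sqrt_divide)

text \<open>At the word \<alpha> the intertwining relation expresses the coordinate of V h at
  \<open>i # \<alpha>\<close> through the coordinate at \<alpha> of V applied to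
  \<open>cadjoint (T i) h\<close>. This recursion on words is solved by \<open>model_coeff\<close>,
  the weights telescoping by \<open>sqrt_b_Cons\<close>.\<close>

lemma intertwines_iff:
  "intertwines b T E V \<longleftrightarrow> bounded_clinear V \<and> range V \<subseteq> fock_tensor E \<and>
    (\<forall>h \<alpha>. ell2_nth (V h) \<alpha> = model_coeff (\<lambda>h. ell2_nth (V h) []) \<alpha> h)"
proof -
  have "V \<circ> cadjoint (T i) = tensor_id (cadjoint (weighted_creation b i)) \<circ> V \<longleftrightarrow>
      (\<forall>h \<alpha>. ell2_nth (V (cadjoint (T i) h)) \<alpha> = sqrt (b \<alpha> / b (i # \<alpha>)) *\<^sub>R ell2_nth (V h) (i # \<alpha>))" for i
    unfolding fun_eq_iff comp_apply tensor_id_cadjoint_weighted_creation[symmetric]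
    by (metis ell2_eqI)
  moreover have "(\<forall>i h \<alpha>. ell2_nth (V (cadjoint (T i) h)) \<alpha> = sqrt (b \<alpha> / b (i # \<alpha>)) *\<^sub>R ell2_nth (V h) (i # \<alpha>))
      \<longleftrightarrow> (\<forall>h \<alpha>. ell2_nth (V h) \<alpha> = model_coeff (\<lambda>h. ell2_nth (V h) []) \<alpha> h)"
    (is "?L \<longleftrightarrow> ?R")
  proof
    assume L: ?L
    have "ell2_nth (V h) \<alpha> = model_coeff (\<lambda>h. ell2_nth (V h) []) \<alpha> h" for h \<alpha>
    proof (induction \<alpha> arbitrary: h)
      case (Cons i \<alpha>)
      have "sqrt (b \<alpha> / b (i # \<alpha>)) *\<^sub>R ell2_nth (V h) (i # \<alpha>)
          = sqrt (b \<alpha> / b (i # \<alpha>)) *\<^sub>R model_coeff (\<lambda>h. ell2_nth (V h) []) (i # \<alpha>) h"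
        unfolding L[rule_format, symmetric] Cons
        by (simp only: model_coeff_def cadjoint_word_op_Cons scaleR_scaleR sqrt_b_Cons)
      \<comment> \<open>Positivity of the weights allows the common factor to be cancelled, which
        solves the recursion for the longer word.\<close>
      moreover have "sqrt (b \<alpha> / b (i # \<alpha>)) \<noteq> 0"
        using b_pos[of \<alpha>] b_pos[of "i # \<alpha>"] by simp
      ultimately show ?case by (rule scaleR_left_imp_eq[rotated])
    qed (simp add: model_coeff_def b_Nil cadjoint_id)
    then show ?R by blast
  next
    assume R: ?R
    show ?L
    proof (intro allI)
      fix i h \<alpha>
      show "ell2_nth (V (cadjoint (T i) h)) \<alpha> = sqrt (b \<alpha> / b (i # \<alpha>)) *\<^sub>R ell2_nth (V h) (i # \<alpha>)"
        unfolding R[rule_format, of _ \<alpha>] R[rule_format, of _ "i # \<alpha>"]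
        by (simp only: model_coeff_def cadjoint_word_op_Cons scaleR_scaleR sqrt_b_Cons)
    qed
  qed
  ultimately show ?thesis unfolding intertwines_def by blast
qed

lemma model_coeff_Nil: "model_coeff \<Theta> [] = \<Theta>"
  by (simp add: model_coeff_def fun_eq_iff b_Nil cadjoint_id)

section \<open>Weak convergence of the series and boundedness of V\<close>

lemma bounded_clinear_model_coeff:
  fixes \<Theta> :: "'h \<Rightarrow> 'e::complex_hilbert"
  assumes "bounded_clinear \<Theta>"
  shows "bounded_clinear (model_coeff \<Theta> \<alpha>)"
proof -
  have "bounded_clinear (\<lambda>x::'e. sqrt (b \<alpha>) *\<^sub>R x)"
    using bounded_clinear_scaleC_right[of "complex_of_real (sqrt (b \<alpha>))"]
    unfolding scaleC_of_real .
  from bounded_clinear_compose[OF this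
      bounded_clinear_compose[OF assms bounded_clinear_cadjoint[OF bounded_clinear_word_op[of \<alpha>]]]]
  show ?thesis by (simp add: model_coeff_def[abs_def] comp_def)
qed

text \<open>Moving the word operator and the adjoint of \<Theta> to the other side leaves one factor
  \<open>sqrt (b \<alpha>)\<close> in each argument.\<close>

lemma cinner_weighted_term:
  fixes \<Theta> :: "'h \<Rightarrow> 'e::complex_hilbert"
  assumes \<Theta>: "bounded_clinear \<Theta>"
  shows "cinner (weighted_term b T (cadjoint \<Theta> \<circ> \<Theta>) \<alpha> x) y
    = cinner (model_coeff \<Theta> \<alpha> x) (model_coeff \<Theta> \<alpha> y)"
proof -
  have "complex_of_real (sqrt (b \<alpha>)) * complex_of_real (sqrt (b \<alpha>)) = complex_of_real (b \<alpha>)"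
    using b_pos[of \<alpha>] by (simp flip: of_real_mult)
  then show ?thesis
    unfolding weighted_term_def model_coeff_def cinner_scaleR_left cinner_scaleR_right comp_apply
      cinner_cadjoint_right[OF bounded_clinear_word_op, symmetric] cinner_cadjoint_left[OF \<Theta>]
    by (simp flip: mult.assoc)
qed

text \<open>The inner product of V x and V y is the sum of those of their coordinates, and sums are
  unique; so the weak sum can only be the adjoint of V composed with V. The choice
  \<open>S = id\<close> leads to the isometry criterion.\<close>

lemma wot_has_sum_weighted_term_iff:
  fixes \<Theta> :: "'h \<Rightarrow> 'e::complex_hilbert"
  assumes \<Theta>: "bounded_clinear \<Theta>" and V: "\<And>h \<alpha>. ell2_nth (V h) \<alpha> = model_coeff \<Theta> \<alpha> h"
  shows "wot_has_sum (weighted_term b T (cadjoint \<Theta> \<circ> \<Theta>)) S UNIV \<longleftrightarrow>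
    bounded_clinear S \<and> (\<forall>x y. cinner (S x) y = cinner (V x) (V y))"
  unfolding wot_has_sum_iff cinner_weighted_term[OF \<Theta>] V[symmetric]
  by (metis has_sum_cinner_ell2 has_sum_unique)

text \<open>From left to right, the weak sum bounds the square sums of the coefficients, which then
  assemble to V. From right to left, the adjoint of V composed with V is the sum.\<close>

lemma wot_summable_weighted_term_iff:
  fixes \<Theta> :: "'h \<Rightarrow> 'e::complex_hilbert"
  assumes \<Theta>: "bounded_clinear \<Theta>"
  shows "wot_summable (weighted_term b T (cadjoint \<Theta> \<circ> \<Theta>)) UNIV \<longleftrightarrow>
    (\<exists>V. bounded_clinear V \<and> (\<forall>h \<alpha>. ell2_nth (V h) \<alpha> = model_coeff \<Theta> \<alpha> h))"
proof
  assume "wot_summable (weighted_term b T (cadjoint \<Theta> \<circ> \<Theta>)) UNIV"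
  then obtain S where S: "bounded_clinear S"
    "\<And>x y. ((\<lambda>\<alpha>. cinner (model_coeff \<Theta> \<alpha> x) (model_coeff \<Theta> \<alpha> y)) has_sum cinner (S x) y) UNIV"
    unfolding wot_summable_def wot_has_sum_iff cinner_weighted_term[OF \<Theta>] by blast
  obtain K where K: "\<And>x. norm (S x) \<le> K * norm x" using bounded_clinear_bound[OF S(1)] by blast
  have "(\<Sum>\<alpha>\<in>F. (norm (model_coeff \<Theta> \<alpha> x))\<^sup>2) \<le> K * (norm x)\<^sup>2" if "finite F" for F x
  proof -
    \<comment> \<open>On the diagonal the terms are nonnegative, so every finite partial sum stays
      below the total.\<close>
    have "((\<lambda>\<alpha>. (norm (model_coeff \<Theta> \<alpha> x))\<^sup>2) has_sum Re (cinner (S x) x)) UNIV"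
      using has_sum_Re[OF S(2)[of x x]] by (simp only: norm_sq_eq_Re_cinner)
    then have "(\<Sum>\<alpha>\<in>F. (norm (model_coeff \<Theta> \<alpha> x))\<^sup>2) \<le> Re (cinner (S x) x)"
      by (rule finite_sum_le_has_sum[OF _ that]) auto
    also have "\<dots> \<le> norm (S x) * norm x"
      using complex_Re_le_cmod cinner_Cauchy_Schwarz order_trans by blast
    also have "\<dots> \<le> K * norm x * norm x" by (intro mult_right_mono K) simp
    finally show ?thesis by (simp add: power2_eq_square mult.assoc)
  qed
  from ell2_operator_exists[OF bounded_clinear_model_coeff[OF \<Theta>] this]
  show "\<exists>V. bounded_clinear V \<and> (\<forall>h \<alpha>. ell2_nth (V h) \<alpha> = model_coeff \<Theta> \<alpha> h)"
    by metis
next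
  assume "\<exists>V. bounded_clinear V \<and> (\<forall>h \<alpha>. ell2_nth (V h) \<alpha> = model_coeff \<Theta> \<alpha> h)"
  then obtain V where V: "bounded_clinear V" "\<And>h \<alpha>. ell2_nth (V h) \<alpha> = model_coeff \<Theta> \<alpha> h" by blast
  have "wot_has_sum (weighted_term b T (cadjoint \<Theta> \<circ> \<Theta>)) (cadjoint V \<circ> V) UNIV"
    unfolding wot_has_sum_weighted_term_iff[OF \<Theta> V(2)]
    by (simp add: V bounded_clinear_compose bounded_clinear_cadjoint cinner_cadjoint_left)
  then show "wot_summable (weighted_term b T (cadjoint \<Theta> \<circ> \<Theta>)) UNIV"
    by (auto simp: wot_summable_def)
qed

text \<open>V and \<Theta> determine each other, \<Theta> being the coordinate of V at the empty
  word. Hence they vanish together, and V takes values in the tensor product with \<open>E\<close>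
  exactly when \<Theta> takes values in \<open>E\<close>.\<close>

lemma has_intertwiner_iff_has_factored_series:
  "has_intertwiner b T TYPE('e::complex_hilbert) \<longleftrightarrow> has_factored_series b T TYPE('e)"
proof
  assume "has_intertwiner b T TYPE('e)"
  then obtain E :: "'e set" and V where E: "hilbert_subspace E" and V: "bounded_clinear V"
    "range V \<subseteq> fock_tensor E" "V \<noteq> (\<lambda>_. 0)"
    and nth: "\<And>h \<alpha>. ell2_nth (V h) \<alpha> = model_coeff (\<lambda>h. ell2_nth (V h) []) \<alpha> h"
    unfolding has_intertwiner_def intertwines_iff by blast
  define \<Theta> where "\<Theta> h = ell2_nth (V h) []" for h
  have \<Theta>: "bounded_clinear \<Theta>"
    using bounded_clinear_compose[OF bounded_clinear_ell2_nth V(1)] by (simp add: \<Theta>_def[abs_def] comp_def)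
  have nth': "ell2_nth (V h) \<alpha> = model_coeff \<Theta> \<alpha> h" for h \<alpha>
    unfolding \<Theta>_def[abs_def] by (rule nth)
  have "\<Theta> \<noteq> (\<lambda>_. 0)"
  proof
    assume "\<Theta> = (\<lambda>_. 0)"
    then have "V h = 0" for h
      by (intro ell2_eqI) (simp add: nth' model_coeff_def zero_ell2.rep_eq)
    with V(3) show False by blast
  qed
  moreover have "range \<Theta> \<subseteq> E"
    using fock_tensorD[OF E] V(2) by (auto simp: \<Theta>_def)
  ultimately show "has_factored_series b T TYPE('e)"
    unfolding has_factored_series_def
    using E \<Theta> V(1) nth' wot_summable_weighted_term_iff[OF \<Theta>] by blast
next
  assume "has_factored_series b T TYPE('e)"
  then obtain E :: "'e set" and \<Theta> where E: "hilbert_subspace E"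
    and \<Theta>: "bounded_clinear \<Theta>" "range \<Theta> \<subseteq> E" "\<Theta> \<noteq> (\<lambda>_. 0)"
    and "wot_summable (weighted_term b T (cadjoint \<Theta> \<circ> \<Theta>)) UNIV"
    unfolding has_factored_series_def by blast
  then obtain V where V: "bounded_clinear V" "\<And>h \<alpha>. ell2_nth (V h) \<alpha> = model_coeff \<Theta> \<alpha> h"
    using wot_summable_weighted_term_iff[OF \<Theta>(1)] by blast
  have Nil: "(\<lambda>h. ell2_nth (V h) []) = \<Theta>" by (simp add: V model_coeff_Nil)
  have "V \<noteq> (\<lambda>_. 0)"
    using Nil \<Theta>(3) by (auto simp: zero_ell2.rep_eq)
  moreover have "model_coeff \<Theta> \<alpha> h \<in> E" for \<alpha> h
    using E \<Theta>(2) complex_vector.subspace_scale[of E _ "complex_of_real (sqrt (b \<alpha>))"]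
    by (auto simp: model_coeff_def hilbert_subspace_def scaleC_of_real)
  then have "range V \<subseteq> fock_tensor E"
    by (auto intro!: fock_tensorI simp: V)
  ultimately show "has_intertwiner b T TYPE('e)"
    unfolding has_intertwiner_def intertwines_iff using E V Nil by metis
qed

text \<open>The witness is the adjoint of \<Theta> composed with \<Theta>; its quadratic form at x
  is the squared norm of \<Theta> x, so it is positive and nonzero.\<close>

lemma has_factored_series_imp_has_positive_series:
  assumes "has_factored_series b T TYPE('e::complex_hilbert)"
  shows "has_positive_series b T"
proof -
  obtain \<Theta> :: "'h \<Rightarrow> 'e" where \<Theta>: "bounded_clinear \<Theta>" "\<Theta> \<noteq> (\<lambda>_. 0)"
    and sum: "wot_summable (weighted_term b T (cadjoint \<Theta> \<circ> \<Theta>)) UNIV"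
    using assms unfolding has_factored_series_def by blast
  have "positive_op (cadjoint \<Theta> \<circ> \<Theta>)"
    by (rule positive_opI)
      (simp_all add: bounded_clinear_compose bounded_clinear_cadjoint \<Theta> cinner_cadjoint_left
        cinner_cadjoint_right cinner_self)
  moreover have "cadjoint \<Theta> \<circ> \<Theta> \<noteq> (\<lambda>_. 0)"
  proof
    assume zero: "cadjoint \<Theta> \<circ> \<Theta> = (\<lambda>_. 0)"
    have "\<Theta> x = 0" for x
      using cinner_cadjoint_left[OF \<Theta>(1), of "\<Theta> x" x] fun_cong[OF zero, of x]
      by (simp add: cinner_self_eq_0)
    with \<Theta>(2) show False by blast
  qed
  ultimately show ?thesis using sum unfolding has_positive_series_def by blast
qed

text \<open>The witness is the square root of D, which acts on \<open>'h\<close> itself; this fixes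
  the auxiliary space at \<open>TYPE('h)\<close>.\<close>

lemma has_positive_series_imp_has_factored_series:
  assumes "has_positive_series b T"
  shows "has_factored_series b T TYPE('h)"
proof -
  obtain D where D: "positive_op D" "D \<noteq> (\<lambda>_. 0)" "wot_summable (weighted_term b T D) UNIV"
    using assms unfolding has_positive_series_def by blast
  note R = positive_opD[OF positive_sqrt_op[OF D(1)]]
  have "sqrt_op D \<noteq> (\<lambda>_. 0)"
    using D(2) sqrt_op_sqrt_op[OF D(1)] by (metis ext)
  then show ?thesis
    unfolding has_factored_series_def
    using R D(3) by (intro exI[of _ UNIV] exI[of _ "sqrt_op D"])
      (simp add: cadjoint_sqrt_op_comp_sqrt_op[OF D(1)] hilbert_subspace_def)
qed

text \<open>For \<Theta> = \<open>sqrt_op D\<close> the model summands are the terms of the basis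
  expansion of V h. So the series converges in norm and \<open>model_map b T D\<close> is V, to
  which the preceding results apply.\<close>

lemma model_map_properties:
  assumes D: "positive_op D" and sum: "wot_summable (weighted_term b T D) UNIV"
  shows "model_summand b T D h summable_on UNIV"
    and "intertwines b T (closure (range D)) (model_map b T D)"
    and "is_isometry (model_map b T D) \<longleftrightarrow> wot_has_sum (weighted_term b T D) id UNIV"
proof -
  let ?R = "sqrt_op D"
  note R = positive_opD[OF positive_sqrt_op[OF D]]
  note RR = cadjoint_sqrt_op_comp_sqrt_op[OF D]
  obtain V where V: "bounded_clinear V" "\<And>h \<alpha>. ell2_nth (V h) \<alpha> = model_coeff ?R \<alpha> h"
    using sum wot_summable_weighted_term_iff[OF R] unfolding RR by blast
  have "model_summand b T D h \<alpha> = \<e> \<alpha> \<otimes> ell2_nth (V h) \<alpha>" for h \<alpha>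
    by (rule ell2_eqI)
      (simp add: model_summand_def V model_coeff_def scaleR_ell2.rep_eq tensor.rep_eq fock_basis.rep_eq scaleC_one)
  then have has_sum: "(model_summand b T D h has_sum V h) UNIV" for h
    using has_sum_fock_basis_tensor[of "V h"] by (simp add: fun_eq_iff[of "model_summand b T D h"] cong: has_sum_cong)
  then show "model_summand b T D h summable_on UNIV" by (rule has_sum_imp_summable)
  have V_eq: "model_map b T D = V"
    unfolding model_map_def[abs_def] using has_sum by (intro ext infsumI)
  have sqrt_range: "?R x \<in> closure (range D)" for x by (rule range_sqrt_op_subset[OF D])
  have "model_coeff ?R \<alpha> h \<in> closure (range D)" for \<alpha> h
    using sqrt_range[of "sqrt (b \<alpha>) *\<^sub>R cadjoint (word_op T \<alpha>) h"]
    by (simp add: model_coeff_def bounded_clinear_scaleR[OF R])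
  then have "range V \<subseteq> fock_tensor (closure (range D))"
    by (auto intro!: fock_tensorI simp: V)
  moreover have "(\<lambda>h. ell2_nth (V h) []) = ?R" by (simp add: V model_coeff_Nil)
  ultimately show "intertwines b T (closure (range D)) (model_map b T D)"
    unfolding V_eq intertwines_iff using V by simp
  \<comment> \<open>Polarization turns preservation of norms into the inner product identity that
    characterizes \<open>id\<close> as the weak sum.\<close>
  have "(\<forall>x. norm (V x) = norm x) \<longleftrightarrow> (\<forall>x y. cinner x y = cinner (V x) (V y))"
  proof
    assume norm: "\<forall>x. norm (V x) = norm x"
    have "cinner x y - cinner (V x) (V y) = 0" for x y
      by (rule sesquilinear_eq_0)
        (simp_all add: cinner_simps bounded_clinear_add[OF V(1)] bounded_clinear_scaleC[OF V(1)]
          cinner_self norm right_diff_distrib)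
    then show "\<forall>x y. cinner x y = cinner (V x) (V y)" by simp
  next
    assume inner: "\<forall>x y. cinner x y = cinner (V x) (V y)"
    have "(norm (V x))\<^sup>2 = (norm x)\<^sup>2" for x
      unfolding norm_sq_eq_Re_cinner using inner by simp
    then show "\<forall>x. norm (V x) = norm x" by (simp add: power2_eq_iff_nonneg)
  qed
  then show "is_isometry (model_map b T D) \<longleftrightarrow> wot_has_sum (weighted_term b T D) id UNIV"
    using wot_has_sum_weighted_term_iff[OF R V(2), of id]
    by (simp add: V_eq is_isometry_def V(1) RR bounded_clinear_id)
qed

end

text \<open>The clauses at \<open>'e\<close> treat an arbitrary auxiliary Hilbert space. The return
  from condition (iii) to (ii) is at \<open>'h\<close>, where the square root of D takes its
  values.\<close>

theorem theorem1p3: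
  fixes b :: "'n::finite list \<Rightarrow> real"
    and T :: "'n \<Rightarrow> 'h::complex_hilbert \<Rightarrow> 'h"
  assumes "\<And>\<alpha>. b \<alpha> > 0" and "b [] = 1"
    and "\<And>i. bdd_above (range (\<lambda>\<alpha>. b \<alpha> / b (i # \<alpha>)))"
    and "\<And>i. bounded_clinear (T i)"
  shows "(has_intertwiner b T TYPE('h) \<longleftrightarrow> has_factored_series b T TYPE('h)) \<and>
    (has_factored_series b T TYPE('h) \<longleftrightarrow> has_positive_series b T) \<and>
    (has_intertwiner b T TYPE('e::complex_hilbert) \<longleftrightarrow> has_factored_series b T TYPE('e)) \<and>
    (has_factored_series b T TYPE('e) \<longrightarrow> has_positive_series b T) \<and>
    (\<forall>D. positive_op D \<and> wot_summable (weighted_term b T D) UNIV \<longrightarrow>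
      (\<forall>h. model_summand b T D h summable_on UNIV) \<and>
      intertwines b T (closure (range D)) (model_map b T D) \<and>
      (is_isometry (model_map b T D) \<longleftrightarrow> wot_has_sum (weighted_term b T D) id UNIV))"
proof -
  interpret weighted_tuple b T by (rule weighted_tuple.intro) (rule assms)+
  show ?thesis
    by (intro conjI allI impI iffI; (elim conjE)?;
      (rule has_intertwiner_iff_has_factored_series[THEN iffD1]
        has_intertwiner_iff_has_factored_series[THEN iffD2]
        has_factored_series_imp_has_positive_series has_positive_series_imp_has_factored_series
        model_map_properties(1,2) model_map_properties(3)[THEN iffD1] model_map_properties(3)[THEN iffD2]; assumption))
qed

end
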